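(* Let $\mathcal{V}$ be a non-octonion symmetric cone of rank $r\neq 2$ in the Euclidean simple Jordan algebra $\mathbb{E}$, and let $\mathcal{D}=\{\mathbf{z}\in\mathcal{V}:\mathbf{e}-\mathbf{z}\in\mathcal{V}\}$. Let $a,b,c\colon\mathcal{V}\to\mathbb{R}$ and $d\colon\mathcal{D}\to\mathbb{R}$ be continuous functions such that $$a(\mathbf{x})+b(\mathbf{y})=c(\mathbf{x}+\mathbf{y})+d\left(\mathbb{P}\left((\mathbf{x}+\mathbf{y})^{-1/2}\right)\mathbf{x}\right)\qquad\text{for all }(\mathbf{x},\mathbf{y})\in\mathcal{V}^2.$$ Then there exist constants $k_1,k_2\in\mathbb{R}$, $\Lambda\in\mathbb{E}$ and $C_1,C_2,C_3,C_4\in\mathbb{R}$ such that for all $\mathbf{x}\in\mathcal{V}$ and $\mathbf{u}\in\mathcal{D}$ $$\begin{aligned}a(\mathbf{x})&=\langle\Lambda,\mathbf{x}\rangle+k_1\log\det(\mathbf{x})+C_1,\\ b(\mathbf{x})&=\langle\Lambda,\mathbf{x}\rangle+k_2\log\det(\mathbf{x})+C_2,\\ c(\mathbf{x})&=\langle\Lambda,\mathbf{x}\rangle+(k_1+k_2)\log\det(\mathbf{x})+C_3,\\ d(\mathbf{u})&=k_1\log\det(\mathbf{u})+k_2\log\det(\mathbf{e}-\mathbf{u})+C_4.\end{aligned}$$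
   Context: A Euclidean Jordan algebra is a finite-dimensional Euclidean space $\mathbb{E}$ with scalar product $\langle\cdot,\cdot\rangle$, a bilinear product $(\mathbf{x},\mathbf{y})\mapsto\mathbf{x}\mathbf{y}$ and a neutral element $\mathbf{e}$ such that $\mathbf{x}\mathbf{y}=\mathbf{y}\mathbf{x}$, $\mathbf{x}(\mathbf{x}^2\mathbf{y})=\mathbf{x}^2(\mathbf{x}\mathbf{y})$, $\mathbf{x}\mathbf{e}=\mathbf{x}$ and $\langle\mathbf{x},\mathbf{y}\mathbf{z}\rangle=\langle\mathbf{x}\mathbf{y},\mathbf{z}\rangle$. It is simple if it is not a Cartesian product of two Euclidean Jordan algebras of positive dimension. Throughout, $\mathbb{E}$ is simple, and "symmetric cone" means the interior $\mathcal{V}$ of the set of squares $\{\mathbf{y}^2:\mathbf{y}\in\mathbb{E}\}$ (i.e. an irreducible symmetric cone). With $\mathbb{L}(\mathbf{x})\mathbf{y}=\mathbf{x}\mathbf{y}$, the quadratic representation is $\mathbb{P}(\mathbf{x})=2\mathbb{L}(\mathbf{x})^2-\mathbb{L}(\mathbf{x}^2)$. A primitive idempotent is $\mathbf{c}\neq 0$ with $\mathbf{c}\mathbf{c}=\mathbf{c}$ that is not a sum of two non-null idempotents. A complete system of primitive orthogonal idempotents is a set $\{\mathbf{c}_1,\dots,\mathbf{c}_r\}$ of primitive idempotents with $\sum_i\mathbf{c}_i=\mathbf{e}$ and $\mathbf{c}_i\mathbf{c}_j=\delta_{ij}\mathbf{c}_i$; its size $r$ is a constant, the rank of $\mathbb{E}$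 (and of $\mathcal{V}$). Every $\mathbf{x}\in\mathbb{E}$ can be written $\mathbf{x}=\sum_{i=1}^r\lambda_i\mathbf{c}_i$ for such a system, with real eigenvalues $\lambda_i$; $\det(\mathbf{x})=\prod_i\lambda_i$. One has $\mathbf{x}\in\mathcal{V}$ iff all $\lambda_i>0$, and then $\mathbf{x}^{-1/2}=\sum_i\lambda_i^{-1/2}\mathbf{c}_i$. Up to isomorphism the Euclidean simple Jordan algebras are $S_r(\mathbb{R})$ ($r\ge1$), $S_r(\mathbb{C})$, $S_r(\mathbb{H})$ ($r\ge2$), $S_3(\mathbb{O})$ (Hermitian $r\times r$ matrices over $\mathbb{R}$, the complexes, quaternions, octonions, with product $\mathbf{x}\mathbf{y}=\frac12(\mathbf{x}\cdot\mathbf{y}+\mathbf{y}\cdot\mathbf{x})$, where $\cdot$ is the matrix product), and the rank-2 algebras $\mathbb{R}^{n+1}$, $n\ge2$, with product $(x_0,\dots,x_n)(y_0,\dots,y_n)=(\sum_{i=0}^n x_iy_i,\,x_0y_1+y_0x_1,\dots,x_0y_n+y_0x_n)$. "Non-octonion" means that $\mathbb{E}$ is not isomorphic to $S_3(\mathbb{O})$. *)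

theory Defs
  imports "HOL-Analysis.Analysis"
begin

section \<open>Euclidean Jordan algebras\<close>

text \<open>
  The algebra lives on a subspace \<open>S\<close> of a Euclidean space, with the inherited scalar product; the
  algebra of interest has carrier \<open>UNIV\<close>, and proper subspaces only serve as the factors
  of a Cartesian product.  Bilinearity is spelled out because it is required on \<open>S\<close> only.
\<close>

definition euclidean_jordan_algebra ::
  "'a::euclidean_space set \<Rightarrow> ('a \<Rightarrow> 'a \<Rightarrow> 'a) \<Rightarrow> 'a \<Rightarrow> bool" where
  "euclidean_jordan_algebra S mul e \<longleftrightarrow>
     subspace S \<and> e \<in> S \<and>
     (\<forall>x\<in>S. \<forall>y\<in>S. mul x y \<in> S) \<and>
     (\<forall>x\<in>S. \<forall>y\<in>S. \<forall>z\<in>S. mul (x + y) z = mul x z + mul y z) \<and>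
     (\<forall>x\<in>S. \<forall>y\<in>S. \<forall>z\<in>S. mul x (y + z) = mul x y + mul x z) \<and>
     (\<forall>t::real. \<forall>x\<in>S. \<forall>y\<in>S. mul (t *\<^sub>R x) y = t *\<^sub>R mul x y \<and>
                               mul x (t *\<^sub>R y) = t *\<^sub>R mul x y) \<and>
     (\<forall>x\<in>S. \<forall>y\<in>S. mul x y = mul y x) \<and>
     (\<forall>x\<in>S. \<forall>y\<in>S. mul x (mul (mul x x) y) = mul (mul x x) (mul x y)) \<and>
     (\<forall>x\<in>S. mul x e = x) \<and>
     (\<forall>x\<in>S. \<forall>y\<in>S. \<forall>z\<in>S. x \<bullet> mul y z = mul x y \<bullet> z)"

text \<open>
  The factors of a Cartesian product have dimension at most that of the whole, so it is no
  restriction to look for them on subspaces of the same type.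
\<close>

definition is_jordan_product :: "('a::euclidean_space \<Rightarrow> 'a \<Rightarrow> 'a) \<Rightarrow> bool" where
  "is_jordan_product mul \<longleftrightarrow>
     (\<exists>S1 S2 mul1 mul2 e1 e2. \<exists>\<phi> :: 'a \<times> 'a \<Rightarrow> 'a.
        euclidean_jordan_algebra S1 mul1 e1 \<and> dim S1 > 0 \<and>
        euclidean_jordan_algebra S2 mul2 e2 \<and> dim S2 > 0 \<and>
        linear \<phi> \<and> bij_betw \<phi> (S1 \<times> S2) UNIV \<and>
        (\<forall>x1\<in>S1. \<forall>x2\<in>S2. \<forall>y1\<in>S1. \<forall>y2\<in>S2.
           \<phi> (mul1 x1 y1, mul2 x2 y2) = mul (\<phi> (x1, x2)) (\<phi> (y1, y2))))"

definition simple_euclidean_jordan_algebra ::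
  "('a::euclidean_space \<Rightarrow> 'a \<Rightarrow> 'a) \<Rightarrow> 'a \<Rightarrow> bool" where
  "simple_euclidean_jordan_algebra mul e \<longleftrightarrow>
     euclidean_jordan_algebra UNIV mul e \<and> \<not> is_jordan_product mul"

definition symmetric_cone :: "('a::euclidean_space \<Rightarrow> 'a \<Rightarrow> 'a) \<Rightarrow> 'a set" where
  "symmetric_cone mul = interior {mul y y | y. True}"

definition quad_rep :: "('a::euclidean_space \<Rightarrow> 'a \<Rightarrow> 'a) \<Rightarrow> 'a \<Rightarrow> 'a \<Rightarrow> 'a" where
  "quad_rep mul x y = 2 *\<^sub>R mul x (mul x y) - mul (mul x x) y"

section \<open>Spectral decomposition\<close>

definition primitive_idempotent :: "('a::euclidean_space \<Rightarrow> 'a \<Rightarrow> 'a) \<Rightarrow> 'a \<Rightarrow> bool" where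
  "primitive_idempotent mul c \<longleftrightarrow>
     c \<noteq> 0 \<and> mul c c = c \<and>
     \<not> (\<exists>a b. a \<noteq> 0 \<and> b \<noteq> 0 \<and> mul a a = a \<and> mul b b = b \<and> c = a + b)"

definition complete_system :: "('a::euclidean_space \<Rightarrow> 'a \<Rightarrow> 'a) \<Rightarrow> 'a \<Rightarrow> 'a set \<Rightarrow> bool" where
  "complete_system mul e C \<longleftrightarrow>
     finite C \<and> (\<forall>c\<in>C. primitive_idempotent mul c) \<and> (\<Sum>c\<in>C. c) = e \<and>
     (\<forall>c\<in>C. \<forall>c'\<in>C. mul c c' = (if c = c' then c else 0))"

text \<open>As for \<^const>\<open>dim\<close>, the choice is immaterial: all complete systems have the same size.\<close>

definition jordan_rank :: "('a::euclidean_space \<Rightarrow> 'a \<Rightarrow> 'a) \<Rightarrow> 'a \<Rightarrow> nat" where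
  "jordan_rank mul e = card (SOME C. complete_system mul e C)"

definition spectral_decomposition ::
  "('a::euclidean_space \<Rightarrow> 'a \<Rightarrow> 'a) \<Rightarrow> 'a \<Rightarrow> 'a \<Rightarrow> 'a set \<Rightarrow> ('a \<Rightarrow> real) \<Rightarrow> bool" where
  "spectral_decomposition mul e x C l \<longleftrightarrow>
     complete_system mul e C \<and> x = (\<Sum>c\<in>C. l c *\<^sub>R c)"

definition jordan_det :: "('a::euclidean_space \<Rightarrow> 'a \<Rightarrow> 'a) \<Rightarrow> 'a \<Rightarrow> 'a \<Rightarrow> real" where
  "jordan_det mul e x =
     (THE d. \<exists>C l. spectral_decomposition mul e x C l \<and> d = (\<Prod>c\<in>C. l c))"

text \<open>Meaningful only for \<open>x\<close> in the symmetric cone, where all eigenvalues are positive.\<close>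

definition inv_sqrt :: "('a::euclidean_space \<Rightarrow> 'a \<Rightarrow> 'a) \<Rightarrow> 'a \<Rightarrow> 'a \<Rightarrow> 'a" where
  "inv_sqrt mul e x =
     (THE y. \<exists>C l. spectral_decomposition mul e x C l \<and>
                   y = (\<Sum>c\<in>C. (l c powr (-1/2)) *\<^sub>R c))"

section \<open>The exceptional algebra of Hermitian 3 by 3 matrices over the octonions\<close>

text \<open>Quaternions and octonions are obtained from \<^typ>\<open>complex\<close> by Cayley-Dickson doubling.\<close>

type_synonym quaternion = "complex \<times> complex"
type_synonym octonion = "quaternion \<times> quaternion"

fun quat_cnj :: "quaternion \<Rightarrow> quaternion" where
  "quat_cnj (a, b) = (cnj a, - b)"

fun quat_mul :: "quaternion \<Rightarrow> quaternion \<Rightarrow> quaternion" where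
  "quat_mul (a, b) (c, d) = (a * c - cnj d * b, d * a + b * cnj c)"

fun oct_cnj :: "octonion \<Rightarrow> octonion" where
  "oct_cnj (p, q) = (quat_cnj p, - q)"

fun oct_mul :: "octonion \<Rightarrow> octonion \<Rightarrow> octonion" where
  "oct_mul (p, q) (r, s) =
     (quat_mul p r - quat_mul (quat_cnj s) q, quat_mul s p + quat_mul q (quat_cnj r))"

definition oct_hermitian :: "(octonion ^ 3 ^ 3) set" where
  "oct_hermitian = {A. \<forall>i j. A $ i $ j = oct_cnj (A $ j $ i)}"

definition oct_matrix_mul :: "octonion ^ 3 ^ 3 \<Rightarrow> octonion ^ 3 ^ 3 \<Rightarrow> octonion ^ 3 ^ 3" where
  "oct_matrix_mul A B = (\<chi> i j. \<Sum>k\<in>UNIV. oct_mul (A $ i $ k) (B $ k $ j))"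

definition oct_jordan_mul :: "octonion ^ 3 ^ 3 \<Rightarrow> octonion ^ 3 ^ 3 \<Rightarrow> octonion ^ 3 ^ 3" where
  "oct_jordan_mul A B = (1/2) *\<^sub>R (oct_matrix_mul A B + oct_matrix_mul B A)"

definition octonion_type :: "('a::euclidean_space \<Rightarrow> 'a \<Rightarrow> 'a) \<Rightarrow> bool" where
  "octonion_type mul \<longleftrightarrow>
     (\<exists>\<phi> :: 'a \<Rightarrow> octonion ^ 3 ^ 3. linear \<phi> \<and> bij_betw \<phi> UNIV oct_hermitian \<and>
        (\<forall>x y. \<phi> (mul x y) = oct_jordan_mul (\<phi> x) (\<phi> y)))"

end

theory Submission
  imports Defs
begin

text \<open>
  Neither Gleason's theorem nor the classification is needed.  A common scaling of \<open>x\<close> and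
  \<open>y\<close> leaves the argument of \<open>d\<close> fixed; the resulting Pexider equation on the cone
  produces \<open>\<Lambda>\<close>, and after subtracting it \<open>a\<close> and \<open>b\<close> change by an additive
  constant under scaling.  Letting the first variable shrink to \<open>0\<close> along two pairs with equal
  quotient removes \<open>d\<close> and shows that \<open>f = a - a e\<close> satisfies
  \<open>f (P(y) x) = f x + f (y\<^sup>2)\<close>.  On a frame this is Cauchy's equation, so
  \<open>f (\<Sum> \<lambda>\<^sub>i c\<^sub>i) = \<Sum> \<kappa>(c\<^sub>i) ln \<lambda>\<^sub>i\<close>.

  Two non-orthogonal primitive idempotents \<open>a\<close>, \<open>b\<close> generate a copy of the symmetric
  \<open>2 \<times> 2\<close> matrices, where an explicit matrix identity gives \<open>\<kappa>(a) = \<kappa>(b)\<close>;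
  they also have the same norm.  In a simple algebra any two primitive idempotents are linked by a chain
  of non-orthogonal ones, since otherwise the spans of two classes would be complementary ideals.
  Hence \<open>\<kappa>\<close> is constant (so \<open>f\<close> is a multiple of the logarithm of the determinant),
  and the norm is constant, which makes the determinant well defined.
\<close>

section \<open>Eigenvectors of self-adjoint maps\<close>

lemma scaleR_3: "3 *\<^sub>R x = x + x + (x::'a::real_vector)"
  using scaleR_add_left[of 1 2 x] by (simp add: scaleR_2)

text \<open>A maximiser \<open>v\<close> of the Rayleigh quotient on the unit sphere of
  \<open>S\<close> is an eigenvector: a nonzero residual \<open>w = T v - m v\<close> would be a
  direction of ascent.\<close>

lemma selfadjoint_eigenvector_exists:
  fixes T :: "'a::euclidean_space \<Rightarrow> 'a"
  assumes T: "linear T" "\<And>x y. T x \<bullet> y = x \<bullet> T y"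
    and S: "subspace S" "T ` S \<subseteq> S" "S \<noteq> {0}"
  obtains v m where "v \<in> S" "v \<noteq> 0" "T v = m *\<^sub>R v"
proof -
  interpret T: linear T by fact
  define K where "K = S \<inter> sphere 0 1"
  obtain w where w: "w \<in> S" "w \<noteq> 0" using S subspace_0 by blast
  then have "w /\<^sub>R norm w \<in> K" using S(1) by (simp add: K_def subspace_scale)
  then have "K \<noteq> {}" by blast
  moreover have "compact K"
    unfolding K_def by (intro closed_Int_compact closed_subspace S) simp
  moreover have "continuous_on K (\<lambda>v. T v \<bullet> v)"
    using T(1) by (intro continuous_intros linear_continuous_on) (rule iffD1[OF linear_conv_bounded_linear])
  ultimately obtain v where v: "v \<in> K" "\<And>u. u \<in> K \<Longrightarrow> T u \<bullet> u \<le> T v \<bullet> v"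
    using continuous_attains_sup[of K "\<lambda>v. T v \<bullet> v"] by blast
  define m where "m = T v \<bullet> v"
  have vv: "v \<in> S" "v \<bullet> v = 1" using v(1) by (auto simp: K_def norm_eq_1)
  have bound: "T u \<bullet> u \<le> m * (u \<bullet> u)" if "u \<in> S" for u
  proof (cases "u = 0")
    case False
    then have "u /\<^sub>R norm u \<in> K" using that S(1) by (simp add: K_def subspace_scale)
    from v(2)[OF this] have "(1 / norm u)\<^sup>2 * (T u \<bullet> u) \<le> m"
      by (simp add: T.scaleR m_def power2_eq_square divide_inverse mult.assoc)
    then show ?thesis using False
      by (simp add: power2_norm_eq_inner[symmetric] divide_le_eq power_divide)
  qed (simp add: T.zero)
  define w where "w = T v - m *\<^sub>R v"
  have wS: "w \<in> S" unfolding w_def using S vv by (intro subspace_diff subspace_scale) auto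
  \<comment> \<open>The maximality bound at \<open>v + t w\<close> is compared with equality at
    \<open>v\<close>; the first-order term is \<open>2 * t * (w \<bullet> w)\<close> because
    \<open>w\<close> is the residual.\<close>
  have key: "2 * t * (w \<bullet> w) \<le> t\<^sup>2 * (m * (w \<bullet> w) - T w \<bullet> w)" for t
  proof -
    have "v + t *\<^sub>R w \<in> S" using vv wS S(1) by (intro subspace_add subspace_scale)
    then have "m + 2 * t * (T v \<bullet> w) + t\<^sup>2 * (T w \<bullet> w) \<le> m * (1 + 2 * t * (v \<bullet> w) + t\<^sup>2 * (w \<bullet> w))"
    proof -
      have "T w \<bullet> v = T v \<bullet> w" using T(2)[of w v] by (simp add: inner_commute)
      moreover have "w \<bullet> v = v \<bullet> w" by (rule inner_commute)
      ultimately show ?thesis using bound[OF \<open>v + t *\<^sub>R w \<in> S\<close>] vv(2)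
        by (simp add: T.add T.scaleR inner_add_left inner_add_right m_def power2_eq_square algebra_simps)
    qed
    moreover have "(T v - m *\<^sub>R v) \<bullet> w = w \<bullet> w" by (simp only: w_def)
    then have "T v \<bullet> w = w \<bullet> w + m * (v \<bullet> w)" by (simp add: inner_diff_left)
    ultimately show ?thesis by (simp add: algebra_simps)
  qed
  have "w \<bullet> w = 0"
  proof (rule ccontr)
    assume "w \<bullet> w \<noteq> 0"
    then have pos: "w \<bullet> w > 0" by simp
    define q where "q = m * (w \<bullet> w) - T w \<bullet> w"
    \<comment> \<open>Small enough that \<open>t * q\<close> is at most
      \<open>w \<bullet> w\<close>, whereas \<open>key\<close> divided by \<open>t\<close> asks for
      at least twice that.\<close>
    define t where "t = (w \<bullet> w) / (\<bar>q\<bar> + 1)"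
    have "t > 0" using pos by (simp add: t_def)
    have "2 * t * (w \<bullet> w) \<le> t * (t * q)" using key[of t] by (simp add: q_def power2_eq_square)
    then have "2 * (w \<bullet> w) \<le> t * q" using \<open>t > 0\<close> by simp
    also have "t * q \<le> t * (\<bar>q\<bar> + 1)" using \<open>t > 0\<close> by simp
    also have "\<dots> = w \<bullet> w" by (simp add: t_def)
    finally show False using pos by simp
  qed
  then have "T v = m *\<^sub>R v" by (simp add: w_def)
  then show ?thesis using that vv by force
qed

text \<open>The orthogonal complement of the eigenvectors inside \<open>S\<close> is invariant under
  \<open>T\<close>; if it were nonzero it would contain an eigenvector orthogonal to itself.\<close>

lemma selfadjoint_span_eigenvectors:
  fixes T :: "'a::euclidean_space \<Rightarrow> 'a"
  assumes T: "linear T" "\<And>x y. T x \<bullet> y = x \<bullet> T y"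
    and S: "subspace S" "T ` S \<subseteq> S"
  shows "S \<subseteq> span {v\<in>S. \<exists>m. T v = m *\<^sub>R v}"
proof
  define W where "W = {v\<in>S. \<exists>m. T v = m *\<^sub>R v}"
  define R where "R = S \<inter> {y. \<forall>w\<in>W. orthogonal w y}"
  interpret T: linear T by fact
  have "subspace R" unfolding R_def
    by (intro subspace_inter S subspace_orthogonal_to_vectors)
  moreover have "T ` R \<subseteq> R"
  proof clarify
    fix y assume y: "y \<in> R"
    have "w \<bullet> T y = 0" if w: "w \<in> W" for w
    proof -
      obtain m where "T w = m *\<^sub>R w" using w by (auto simp: W_def)
      then show ?thesis using y w T(2)[of w y] by (auto simp: R_def orthogonal_def)
    qed
    then show "T y \<in> R" using y S(2) by (auto simp: R_def orthogonal_def)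
  qed
  ultimately have R0: "R = {0}"
  proof -
    have False if "R \<noteq> {0}"
    proof -
      obtain v m where v: "v \<in> R" "v \<noteq> 0" "T v = m *\<^sub>R v"
        using selfadjoint_eigenvector_exists[OF T \<open>subspace R\<close> \<open>T ` R \<subseteq> R\<close> \<open>R \<noteq> {0}\<close>] .
      then have "v \<in> W" by (auto simp: W_def R_def)
      then show False using v by (auto simp: R_def orthogonal_def)
    qed
    then show ?thesis by blast
  qed
  fix x assume x: "x \<in> S"
  obtain y z where yz: "y \<in> span W" "\<And>w. w \<in> span W \<Longrightarrow> orthogonal z w" "x = y + z"
    using orthogonal_subspace_decomp_exists by blast
  have "span W \<subseteq> S" using S(1) by (intro span_minimal) (auto simp: W_def)
  then have "z \<in> S" using yz x S(1) by (metis add_diff_cancel_left' subset_iff subspace_diff)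
  then have "z \<in> R" using yz(2) by (auto simp: R_def span_base orthogonal_commute)
  then show "x \<in> span {v\<in>S. \<exists>m. T v = m *\<^sub>R v}" using R0 yz by (simp add: W_def)
qed

section \<open>Jordan identities\<close>

locale eja =
  fixes mul :: "'a::euclidean_space \<Rightarrow> 'a \<Rightarrow> 'a" (infixl "\<odot>" 70) and e :: 'a
  assumes eja: "euclidean_jordan_algebra UNIV mul e"
begin

lemma comm: "x \<odot> y = y \<odot> x"
  and unit_right [simp]: "x \<odot> e = x"
  and inner_assoc: "x \<bullet> (y \<odot> z) = (x \<odot> y) \<bullet> z"
  and jordan: "x \<odot> (x \<odot> x \<odot> y) = x \<odot> x \<odot> (x \<odot> y)"
  using eja unfolding euclidean_jordan_algebra_def by blast+

lemma unit_left [simp]: "e \<odot> x = x"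
  by (subst comm) simp

lemma bounded_bilinear_mul: "bounded_bilinear mul"
proof -
  have "bilinear mul"
    using eja unfolding euclidean_jordan_algebra_def bilinear_def
    by (intro conjI allI linearI) blast+
  then show ?thesis by (simp add: bilinear_conv_bounded_bilinear)
qed

sublocale mul: bounded_bilinear mul
  by (rule bounded_bilinear_mul)

declare mul.zero_left [simp] mul.zero_right [simp]

lemmas mul_simps = mul.add_left mul.add_right mul.diff_left mul.diff_right
  mul.scaleR_left mul.scaleR_right mul.minus_left mul.minus_right

text \<open>Polarisation: \<open>G\<close> is cubic in its argument, and the alternating sum of its
  values isolates the part linear in each of \<open>x\<close>, \<open>y\<close>, \<open>z\<close>,
  which is twice the difference of the two sides.\<close>

lemma jordan_linearized:
  "x \<odot> (y \<odot> z \<odot> w) + y \<odot> (z \<odot> x \<odot> w) + z \<odot> (x \<odot> y \<odot> w) =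
   y \<odot> z \<odot> (x \<odot> w) + z \<odot> x \<odot> (y \<odot> w) + x \<odot> y \<odot> (z \<odot> w)"
proof -
  define G where "G x = x \<odot> (x \<odot> x \<odot> w) - x \<odot> x \<odot> (x \<odot> w)" for x
  have G0: "G x = 0" for x by (simp add: G_def jordan)
  have "0 = G (x + y + z) - G (x + y) - G (y + z) - G (x + z) + G x + G y + G z"
    by (simp add: G0)
  also have "\<dots> = 2 *\<^sub>R ((x \<odot> (y \<odot> z \<odot> w) + y \<odot> (z \<odot> x \<odot> w) + z \<odot> (x \<odot> y \<odot> w)) -
     (y \<odot> z \<odot> (x \<odot> w) + z \<odot> x \<odot> (y \<odot> w) + x \<odot> y \<odot> (z \<odot> w)))"
    unfolding G_def mul_simps scaleR_2 by (simp add: algebra_simps comm)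
  finally show ?thesis by simp
qed

text \<open>The right-hand side of \<open>jordan_linearized\<close> is symmetric in all four
  variables, so exchanging \<open>x\<close> and \<open>w\<close> equates two left-hand sides. Solved
  for one term, this expresses multiplication by a triple product through multiplications by shorter
  products.\<close>

lemma mul_triple:
  "x \<odot> (y \<odot> z) \<odot> w = x \<odot> (y \<odot> z \<odot> w) + y \<odot> (z \<odot> x \<odot> w) + z \<odot> (x \<odot> y \<odot> w)
     - y \<odot> (x \<odot> (z \<odot> w)) - z \<odot> (x \<odot> (y \<odot> w))"
  using jordan_linearized[of x y z w] jordan_linearized[of w y z x]
  by (simp add: algebra_simps comm)

abbreviation P where "P \<equiv> quad_rep mul"

lemmas P_eq = quad_rep_def[of mul]

text \<open>The Peirce polynomial 2 L^3 - 3 L^2 + L = 0 for multiplication L by \<open>c\<close>, so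
  the possible eigenvalues are 0, 1/2 and 1. It is \<open>mul_triple\<close> with three factors
  \<open>c\<close>.\<close>

lemma idem_cubic:
  assumes "c \<odot> c = c"
  shows "c \<odot> v = 3 *\<^sub>R (c \<odot> (c \<odot> v)) - 2 *\<^sub>R (c \<odot> (c \<odot> (c \<odot> v)))"
proof -
  have "c \<odot> v = (c \<odot> (c \<odot> v) + c \<odot> (c \<odot> v) + c \<odot> (c \<odot> v)) - (c \<odot> (c \<odot> (c \<odot> v)) + c \<odot> (c \<odot> (c \<odot> v)))"
    using mul_triple[of c c c v] assms by (simp add: algebra_simps)
  then show ?thesis by (simp add: scaleR_2 algebra_simps flip: scaleR_add_left[of 1 2, simplified])
qed

lemma commute_0: "c \<odot> c = c \<Longrightarrow> c \<odot> z = 0 \<Longrightarrow> c \<odot> (z \<odot> v) = z \<odot> (c \<odot> v)"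
  using jordan_linearized[of c c z v] by (simp add: comm[of z c])

lemma commute_1: "c \<odot> c = c \<Longrightarrow> c \<odot> z = z \<Longrightarrow> c \<odot> (z \<odot> v) = z \<odot> (c \<odot> v)"
  using jordan_linearized[of c c z v] by (simp add: comm[of z c])

lemma adj: "(c \<odot> x) \<bullet> y = x \<bullet> (c \<odot> y)"
  by (simp add: inner_assoc comm)

text \<open>With \<open>w = c \<odot> v\<close>, the cubic relation turns
  \<open>w \<bullet> v\<close> into the sum of squares |w|^2 + 4 |w - c w|^2.\<close>

lemma idem_psd:
  assumes c: "c \<odot> c = c"
  shows "0 \<le> (c \<odot> v) \<bullet> v"
proof -
  define w where "w = c \<odot> v"
  have 1: "w = 3 *\<^sub>R (c \<odot> w) - 2 *\<^sub>R (c \<odot> (c \<odot> w))"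
    unfolding w_def by (rule idem_cubic[OF c])
  have "w \<bullet> v = 3 * ((c \<odot> w) \<bullet> v) - 2 * ((c \<odot> (c \<odot> w)) \<bullet> v)"
    by (metis 1 inner_diff_left inner_scaleR_left)
  then have a: "w \<bullet> v = 3 * (w \<bullet> w) - 2 * ((c \<odot> w) \<bullet> w)"
    by (simp only: adj[of c _ v] w_def[symmetric])
  have "w \<bullet> w = 3 * ((c \<odot> w) \<bullet> w) - 2 * ((c \<odot> (c \<odot> w)) \<bullet> w)"
    by (metis 1 inner_diff_left inner_scaleR_left)
  then have b: "w \<bullet> w = 3 * ((c \<odot> w) \<bullet> w) - 2 * ((c \<odot> w) \<bullet> (c \<odot> w))"
    by (simp only: adj[of c _ w])
  have "(w - c \<odot> w) \<bullet> (w - c \<odot> w) = w \<bullet> w - 2 * ((c \<odot> w) \<bullet> w) + (c \<odot> w) \<bullet> (c \<odot> w)"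
    by (simp add: inner_diff_left inner_diff_right inner_commute)
  with a b have "w \<bullet> v = w \<bullet> w + 4 * ((w - c \<odot> w) \<bullet> (w - c \<odot> w))" by simp
  then show ?thesis unfolding w_def by simp
qed

end

section \<open>Spectral decomposition\<close>

context eja begin

definition pow :: "'a \<Rightarrow> nat \<Rightarrow> 'a" where "pow x n = ((\<odot>) x ^^ n) e"

lemma pow_0 [simp]: "pow x 0 = e" and pow_Suc: "pow x (Suc n) = x \<odot> pow x n"
  by (simp_all add: pow_def)

text \<open>Induction in steps of two: \<open>mul_triple\<close> writes multiplication by x^(k+2)
  through multiplications by x, x^2, x^k and x^(k+1), each of which commutes with
  \<open>T\<close>.\<close>

lemma commute_pow:
  assumes "linear T" and 1: "\<And>v. T (x \<odot> v) = x \<odot> T v"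
    and 2: "\<And>v. T (x \<odot> x \<odot> v) = x \<odot> x \<odot> T v"
  shows "T (pow x n \<odot> v) = pow x n \<odot> T v"
proof (induction n arbitrary: v rule: less_induct)
  case (less n)
  interpret T: linear T by fact
  consider "n = 0" | "n = 1" | k where "n = Suc (Suc k)" by (metis One_nat_def not0_implies_Suc)
  then show ?case
  proof cases
    case 3
    have IH: "T (pow x k \<odot> v) = pow x k \<odot> T v" "T (x \<odot> pow x k \<odot> v) = x \<odot> pow x k \<odot> T v" for v
      using less[of k v] less[of "Suc k" v] 3 by (simp_all add: pow_Suc)
    have *: "pow x n \<odot> v = x \<odot> (x \<odot> pow x k \<odot> v) + x \<odot> (x \<odot> pow x k \<odot> v) + pow x k \<odot> (x \<odot> x \<odot> v)
      - x \<odot> (x \<odot> (pow x k \<odot> v)) - pow x k \<odot> (x \<odot> (x \<odot> v))" for v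
      unfolding 3 pow_Suc mul_triple[of x x "pow x k"] by (simp add: comm)
    show ?thesis unfolding * by (simp add: T.add T.diff IH 1 2)
  qed (simp_all add: pow_Suc 1)
qed

lemma linear_mul: "linear ((\<odot>) x)"
  by (rule linearI) (simp_all add: mul_simps)

text \<open>Two rounds of \<open>commute_pow\<close>: with \<open>T\<close> multiplication by x or
  x^2, these commute with every power; then \<open>T\<close> can be multiplication by x^m.\<close>

lemma pow_commute: "pow x m \<odot> (pow x n \<odot> v) = pow x n \<odot> (pow x m \<odot> v)"
proof (rule commute_pow[OF linear_mul])
  have x: "x \<odot> (pow x m \<odot> v) = pow x m \<odot> (x \<odot> v)" for v
    by (rule commute_pow[OF linear_mul]) (simp_all add: jordan)
  have x2: "x \<odot> x \<odot> (pow x m \<odot> v) = pow x m \<odot> (x \<odot> x \<odot> v)" for v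
    by (rule commute_pow[OF linear_mul]) (simp_all add: jordan)
  show "pow x m \<odot> (x \<odot> v) = x \<odot> (pow x m \<odot> v)" "pow x m \<odot> (x \<odot> x \<odot> v) = x \<odot> x \<odot> (pow x m \<odot> v)" for v
    by (simp_all add: x x2)
qed

definition gen :: "'a \<Rightarrow> 'a set" where "gen x = span (range (pow x))"

lemma gen_commute:
  assumes "y \<in> gen x" "z \<in> gen x"
  shows "y \<odot> (z \<odot> v) = z \<odot> (y \<odot> v)"
proof -
  have 1: "y \<odot> (pow x n \<odot> v) = pow x n \<odot> (y \<odot> v)" for n v
    using assms(1) unfolding gen_def
  proof (induction rule: span_induct_alt)
    case (step c w y) then show ?case by (auto simp: mul_simps pow_commute)
  qed simp
  show ?thesis using assms(2) unfolding gen_def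
  proof (induction rule: span_induct_alt)
    case (step c w y) then show ?case by (auto simp: mul_simps 1)
  qed simp
qed

lemma e_in_gen: "e \<in> gen x" and self_in_gen: "x \<in> gen x"
  using span_base[OF rangeI, of "pow x" 0] span_base[OF rangeI, of "pow x" 1]
  by (simp_all add: gen_def pow_Suc)

lemma mul_gen: "y \<in> gen x \<Longrightarrow> x \<odot> y \<in> gen x"
  unfolding gen_def
proof (induction rule: span_induct_alt)
  case (step c w y)
  then obtain n where w: "w = pow x n" by blast
  have "x \<odot> w \<in> span (range (pow x))" unfolding w pow_Suc[symmetric] by (intro span_base) blast
  then show ?case using step by (simp add: mul_simps span_add span_scale)
qed (simp add: span_zero)

text \<open>\<open>S\<close> may fail to contain \<open>e\<close>, so a polynomial in
  \<open>x\<close> with a constant term may lie outside \<open>S\<close>; multiplying by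
  \<open>x\<close> removes that term.\<close>

lemma mul_gen_closed:
  assumes S: "subspace S" "x \<in> S" "\<And>y z. y \<in> S \<Longrightarrow> z \<in> S \<Longrightarrow> y \<odot> z \<in> S" and "y \<in> gen x"
  shows "x \<odot> y \<in> S"
proof -
  have x_pow: "x \<odot> pow x n \<in> S" for n by (induction n) (auto simp: S pow_Suc)
  from assms(4) show ?thesis unfolding gen_def
  proof (induction rule: span_induct_alt)
    case (step c w y)
    then show ?case using x_pow by (auto simp: mul_simps S(1) intro!: subspace_add subspace_scale)
  qed (simp add: S(1) subspace_0)
qed

text \<open>Weaker than \<^const>\<open>complete_system\<close>: the idempotents need not be primitive.\<close>

definition idem_system :: "'a set \<Rightarrow> bool" where
  "idem_system C \<longleftrightarrow> finite C \<and> (\<forall>c\<in>C. c \<noteq> 0 \<and> c \<odot> c = c) \<and>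
     (\<forall>c\<in>C. \<forall>c'\<in>C. c \<noteq> c' \<longrightarrow> c \<odot> c' = 0) \<and> \<Sum>C = e"

text \<open>Multiplication by \<open>x\<close> is self-adjoint, so \<open>e\<close> splits inside
  \<open>gen x\<close> into eigenvectors, grouped by eigenvalue into \<open>g m\<close>.
  Multiplications by elements of \<open>gen x\<close> commute, so distinct groups annihilate each
  other; as they sum to \<open>e\<close>, they are idempotents. The last clause covers subalgebras
  without \<open>e\<close> and is used for Peirce 1-spaces.\<close>

lemma idem_spectral:
  obtains C l where "idem_system C" "x = (\<Sum>c\<in>C. l c *\<^sub>R c)"
    "\<forall>S. subspace S \<and> x \<in> S \<and> (\<forall>y\<in>S. \<forall>z\<in>S. y \<odot> z \<in> S) \<longrightarrow> (\<forall>c\<in>C. l c \<noteq> 0 \<longrightarrow> c \<in> S)"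
proof -
  have "subspace (gen x)" by (simp add: gen_def)
  have "gen x \<subseteq> span {v\<in>gen x. \<exists>m. x \<odot> v = m *\<^sub>R v}"
    by (rule selfadjoint_span_eigenvectors[OF linear_mul adj \<open>subspace (gen x)\<close>]) (auto intro: mul_gen)
  from subsetD[OF this e_in_gen] obtain t r where t: "finite t" "t \<subseteq> {v\<in>gen x. \<exists>m. x \<odot> v = m *\<^sub>R v}" "e = (\<Sum>v\<in>t. r v *\<^sub>R v)"
    unfolding span_explicit mem_Collect_eq
    by (elim exE conjE) (rule that)
  from t(2) have "\<forall>v\<in>t. \<exists>m. v \<in> gen x \<and> x \<odot> v = m *\<^sub>R v" by blast
  then obtain \<mu> where \<mu>: "\<And>v. v \<in> t \<Longrightarrow> v \<in> gen x \<and> x \<odot> v = \<mu> v *\<^sub>R v" by metis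
  define g where "g m = (\<Sum>v\<in>{v\<in>t. \<mu> v = m}. r v *\<^sub>R v)" for m
  have g_gen: "g m \<in> gen x" for m
    unfolding g_def using \<mu> \<open>subspace (gen x)\<close> by (intro subspace_sum subspace_scale) auto
  have xg: "x \<odot> g m = m *\<^sub>R g m" for m
    unfolding g_def mul.sum_right scaleR_sum_right using \<mu> by (intro sum.cong) (auto simp: mul_simps)
  have sum_g: "(\<Sum>m\<in>\<mu> ` t. g m) = e"
    unfolding t(3) g_def using t(1) by (subst sum.image_gen[of t _ \<mu>]) auto
  \<comment> \<open>Multiplying \<open>g m \<odot> g m'\<close> by \<open>x\<close> can be moved
    onto either factor, giving the factor \<open>m\<close> or the factor \<open>m'\<close>.\<close>
  have orth: "g m \<odot> g m' = 0" if "m \<noteq> m'" for m m'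
  proof -
    have "m *\<^sub>R (g m \<odot> g m') = g m' \<odot> (x \<odot> g m)" by (simp add: xg mul_simps comm[of "g m'"])
    also have "\<dots> = x \<odot> (g m' \<odot> g m)" by (rule gen_commute[OF g_gen self_in_gen])
    also have "\<dots> = x \<odot> (g m \<odot> g m')" by (simp only: comm[of "g m'"])
    also have "\<dots> = g m \<odot> (x \<odot> g m')" by (rule gen_commute[OF self_in_gen g_gen])
    also have "\<dots> = m' *\<^sub>R (g m \<odot> g m')" by (simp add: xg mul_simps)
    finally show ?thesis using that by simp
  qed
  have idem: "g m \<odot> g m = g m" if "m \<in> \<mu> ` t" for m
  proof -
    have "g m = g m \<odot> (\<Sum>m'\<in>\<mu> ` t. g m')" by (simp add: sum_g)
    also have "\<dots> = (\<Sum>m'\<in>\<mu> ` t. if m' = m then g m \<odot> g m else 0)"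
      unfolding mul.sum_right by (intro sum.cong) (auto simp: orth)
    also have "\<dots> = g m \<odot> g m" using that t(1) by simp
    finally show ?thesis by simp
  qed
  \<comment> \<open>Groups may sum to zero; on the others \<open>g\<close> is injective, so
    eigenvalues can be read off from idempotents.\<close>
  define M where "M = {m\<in>\<mu> ` t. g m \<noteq> 0}"
  have inj: "inj_on g M"
  proof (rule inj_onI)
    fix m m' assume "m \<in> M" "m' \<in> M" "g m = g m'"
    then show "m = m'" using orth[of m m'] idem[of m] by (auto simp: M_def)
  qed
  have "finite M" using t(1) by (simp add: M_def)
  define l where "l = inv_into M g"
  have l: "l (g m) = m" if "m \<in> M" for m using inj that by (simp add: l_def)
  have sumM: "(\<Sum>m\<in>M. g m) = e"
    unfolding sum_g[symmetric] M_def using t(1) by (intro sum.mono_neutral_left) auto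
  show ?thesis
  proof
    show "idem_system (g ` M)"
    proof -
      have "g m \<odot> g m' = 0" if "g m \<noteq> g m'" for m m' using that orth[of m m'] by blast
      moreover have "g m \<noteq> 0 \<and> g m \<odot> g m = g m" if "m \<in> M" for m using that idem by (auto simp: M_def)
      moreover have "\<Sum>(g ` M) = e" using inj by (simp add: sum.reindex sumM)
      ultimately show ?thesis unfolding idem_system_def using \<open>finite M\<close> by auto
    qed
    have "x = x \<odot> (\<Sum>m\<in>M. g m)" by (simp add: sumM)
    also have "\<dots> = (\<Sum>m\<in>M. l (g m) *\<^sub>R g m)"
      unfolding mul.sum_right by (intro sum.cong) (auto simp: xg l)
    also have "\<dots> = (\<Sum>c\<in>g ` M. l c *\<^sub>R c)" using inj by (simp add: sum.reindex)
    finally show "x = (\<Sum>c\<in>g ` M. l c *\<^sub>R c)" .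
    show "\<forall>S. subspace S \<and> x \<in> S \<and> (\<forall>y\<in>S. \<forall>z\<in>S. y \<odot> z \<in> S) \<longrightarrow> (\<forall>c\<in>g ` M. l c \<noteq> 0 \<longrightarrow> c \<in> S)"
    proof (intro allI impI ballI; elim conjE)
      fix S c assume S: "subspace S" "x \<in> S" "\<forall>y\<in>S. \<forall>z\<in>S. y \<odot> z \<in> S" "c \<in> g ` M" "l c \<noteq> 0"
      from S(4) obtain m where m: "m \<in> M" "c = g m" by blast
      have "m *\<^sub>R c \<in> S" using mul_gen_closed[OF S(1,2) S(3)[rule_format] g_gen[of m]] m by (simp add: xg)
      from subspace_scale[OF S(1) this, of "1 / m"] show "c \<in> S" using S(5) m l by simp
    qed
  qed
qed

end

section \<open>Refinement to primitive idempotents and functional calculus\<close>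

context eja begin

lemma idem_systemD:
  assumes "idem_system C"
  shows "finite C" "\<Sum>C = e" "\<And>c. c \<in> C \<Longrightarrow> c \<noteq> 0" "\<And>c. c \<in> C \<Longrightarrow> c \<odot> c = c"
    "\<And>c c'. c \<in> C \<Longrightarrow> c' \<in> C \<Longrightarrow> c \<noteq> c' \<Longrightarrow> c \<odot> c' = 0"
  using assms unfolding idem_system_def by blast+

text \<open>Annihilating idempotents are orthogonal, hence independent. The bound guarantees a
  system of maximal size in \<open>spectral\<close>.\<close>

lemma idem_system_card: "idem_system C \<Longrightarrow> card C \<le> DIM('a)"
proof -
  assume C: "idem_system C"
  note D = idem_systemD[OF C]
  have "c \<bullet> c' = 0" if "c \<in> C" "c' \<in> C" "c \<noteq> c'" for c c'
    using D(4,5) that by (metis adj inner_zero_right)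
  then have "pairwise orthogonal C" by (simp add: pairwise_def orthogonal_def)
  moreover have "0 \<notin> C" using D(3) by blast
  ultimately show ?thesis by (meson independent_bound pairwise_orthogonal_independent)
qed

lemma idem_sum_orth:
  assumes "a \<odot> a = a" "b \<odot> b = b" "(a + b) \<odot> (a + b) = a + b"
  shows "a \<odot> b = 0"
proof -
  have "a \<odot> b + a \<odot> b = 0" using assms by (simp add: mul_simps comm[of b a])
  then show ?thesis by (metis scaleR_2 scaleR_eq_0_iff zero_neq_numeral)
qed

text \<open>The parts \<open>a\<close>, \<open>b\<close> lie in the Peirce 1-space of
  \<open>c\<close> and the other members in its Peirce 0-space; \<open>commute_0\<close> and
  \<open>commute_1\<close> together make these two spaces annihilate each other.\<close>

lemma idem_system_split:
  assumes C: "idem_system C" and c: "c \<in> C" "c = a + b"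
    and a: "a \<noteq> 0" "a \<odot> a = a" and b: "b \<noteq> 0" "b \<odot> b = b"
  shows "idem_system (insert a (insert b (C - {c})))" "a \<noteq> b" "a \<notin> C - {c}" "b \<notin> C - {c}"
proof -
  note D = idem_systemD[OF C]
  have ab: "a \<odot> b = 0" using idem_sum_orth a b c D(4)[OF c(1)] by blast
  have ca: "c \<odot> a = a" and cb: "c \<odot> b = b" using ab a b by (simp_all add: c mul_simps comm[of b a])
  have orth: "z \<odot> c' = 0" if z: "c \<odot> z = z" and c': "c' \<in> C - {c}" for z c'
  proof -
    have cc': "c \<odot> c' = 0" using D(5) c(1) c' by blast
    have "z \<odot> c' = c' \<odot> (c \<odot> z)" by (simp add: z comm)
    also have "\<dots> = c \<odot> (c' \<odot> z)" using commute_0[OF D(4)[OF c(1)] cc'] by simp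
    also have "\<dots> = c \<odot> (z \<odot> c')" by (simp add: comm)
    also have "\<dots> = z \<odot> (c \<odot> c')" using commute_1[OF D(4)[OF c(1)] z] by simp
    finally show ?thesis by (simp add: cc')
  qed
  show neq: "a \<noteq> b" using ab a by auto
  show aC: "a \<notin> C - {c}" using orth[OF ca, of a] a by auto
  show bC: "b \<notin> C - {c}" using orth[OF cb, of b] b by auto
  have "a + (b + \<Sum>(C - {c})) = e" using D(1,2) c by (simp add: sum_diff1)
  then have "\<Sum>(insert a (insert b (C - {c}))) = e"
    using D(1) aC bC neq by (subst sum.insert; simp)
  then show "idem_system (insert a (insert b (C - {c})))"
    unfolding idem_system_def using D(1,3,4,5) a b ab orth[OF ca] orth[OF cb]
    by (auto simp: comm)
qed

lemma complete_system_iff: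
  "complete_system mul e C \<longleftrightarrow> idem_system C \<and> (\<forall>c\<in>C. primitive_idempotent mul c)"
  unfolding complete_system_def idem_system_def primitive_idempotent_def by auto

text \<open>Among the systems that diagonalise \<open>x\<close>, one of maximal size is primitive:
  splitting a member and giving both parts its eigenvalue would produce a larger one.\<close>

lemma spectral:
  obtains C l where "complete_system mul e C" "x = (\<Sum>c\<in>C. l c *\<^sub>R c)"
proof -
  define Q where "Q C \<longleftrightarrow> idem_system C \<and> (\<exists>l. x = (\<Sum>c\<in>C. l c *\<^sub>R c))" for C
  have ex: "\<exists>C. Q C" using idem_spectral[of x] unfolding Q_def by metis
  have "\<forall>C. Q C \<longrightarrow> card C < Suc DIM('a)" using idem_system_card by (auto simp: Q_def less_Suc_eq_le)
  then obtain C where C: "Q C" "\<And>C'. Q C' \<Longrightarrow> card C' \<le> card C"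
    using ex_has_greatest_nat[of Q _ card] ex by blast
  then obtain l where l: "x = (\<Sum>c\<in>C. l c *\<^sub>R c)" unfolding Q_def by blast
  have sys: "idem_system C" using C(1) by (simp add: Q_def)
  note D = idem_systemD[OF sys]
  have "primitive_idempotent mul c" if c: "c \<in> C" for c
  proof (rule ccontr)
    assume "\<not> primitive_idempotent mul c"
    then obtain a b where ab: "a \<noteq> 0" "b \<noteq> 0" "a \<odot> a = a" "b \<odot> b = b" "c = a + b"
      using D(3,4)[OF c] unfolding primitive_idempotent_def by blast
    note S = idem_system_split[OF sys c ab(5) ab(1,3) ab(2,4)]
    define l' where "l' = l(a := l c, b := l c)"
    have "x = l c *\<^sub>R c + (\<Sum>c\<in>C - {c}. l c *\<^sub>R c)" unfolding l using D(1) c by (rule sum.remove)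
    also have "\<dots> = l c *\<^sub>R a + (l c *\<^sub>R b + (\<Sum>c\<in>C - {c}. l c *\<^sub>R c))" using ab(5) by (simp add: scaleR_add_right)
    also have "(\<Sum>c\<in>C - {c}. l c *\<^sub>R c) = (\<Sum>c\<in>C - {c}. l' c *\<^sub>R c)"
      using S(3,4) by (intro sum.cong) (auto simp: l'_def)
    also have "l c *\<^sub>R a + (l c *\<^sub>R b + (\<Sum>c\<in>C - {c}. l' c *\<^sub>R c)) = (\<Sum>c\<in>insert a (insert b (C - {c})). l' c *\<^sub>R c)"
      using D(1) S by (simp add: l'_def)
    finally have "Q (insert a (insert b (C - {c})))" unfolding Q_def using S(1) by blast
    from C(2)[OF this] have "Suc (Suc (card (C - {c}))) \<le> card C" using D(1) S by simp
    then show False using D(1) c by (simp add: card_Suc_Diff1)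
  qed
  then show ?thesis using that sys l complete_system_iff by blast
qed

lemma idem_system_mul_sum:
  assumes C: "idem_system C" "c \<in> C"
  shows "(\<Sum>c\<in>C. l c *\<^sub>R c) \<odot> c = l c *\<^sub>R c"
proof -
  note D = idem_systemD[OF C(1)]
  have "(\<Sum>c\<in>C. l c *\<^sub>R c) \<odot> c = (\<Sum>c'\<in>C. if c' = c then l c *\<^sub>R c else 0)"
    unfolding mul.sum_left using D(4,5) C(2) by (intro sum.cong) (auto simp: mul_simps)
  also have "\<dots> = l c *\<^sub>R c" using D(1) C(2) by simp
  finally show ?thesis .
qed

lemma idem_system_commute:
  assumes C: "idem_system C" "c \<in> C"
  shows "(\<Sum>c\<in>C. l c *\<^sub>R c) \<odot> (c \<odot> v) = c \<odot> ((\<Sum>c\<in>C. l c *\<^sub>R c) \<odot> v)"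
proof -
  note D = idem_systemD[OF C(1)]
  have "c' \<odot> (c \<odot> v) = c \<odot> (c' \<odot> v)" if "c' \<in> C" for c'
    using commute_0[OF D(4)[OF C(2)], of c'] D(5)[OF C(2) that] by (cases "c = c'") auto
  then show ?thesis unfolding mul.sum_left mul.sum_right
    by (intro sum.cong) (auto simp: mul_simps)
qed

text \<open>\<open>x\<close> acts on \<open>c \<odot> c'\<close> with either eigenvalue, so the
  product vanishes unless \<open>l c = l' c'\<close>. Since both systems sum to \<open>e\<close>,
  both sides expand into the same double sum over these products.\<close>

lemma functional_calculus_unique:
  assumes C: "idem_system C" and C': "idem_system C'"
    and eq: "(\<Sum>c\<in>C. l c *\<^sub>R c) = (\<Sum>c\<in>C'. l' c *\<^sub>R c)"
  shows "(\<Sum>c\<in>C. h (l c) *\<^sub>R c) = (\<Sum>c\<in>C'. h (l' c) *\<^sub>R (c::'a))"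
proof -
  define x where "x = (\<Sum>c\<in>C. l c *\<^sub>R c)"
  have x': "x = (\<Sum>c\<in>C'. l' c *\<^sub>R c)" by (simp add: x_def eq)
  have orth: "c \<odot> c' = 0" if c: "c \<in> C" "c' \<in> C'" "l c \<noteq> l' c'" for c c'
  proof -
    have "l c *\<^sub>R (c' \<odot> c) = c' \<odot> (x \<odot> c)"
      unfolding x_def by (simp add: idem_system_mul_sum[OF C c(1)] mul_simps)
    also have "\<dots> = x \<odot> (c' \<odot> c)" unfolding x' by (rule idem_system_commute[OF C' c(2), symmetric])
    also have "\<dots> = x \<odot> (c \<odot> c')" by (simp add: comm)
    also have "\<dots> = c \<odot> (x \<odot> c')" unfolding x_def by (rule idem_system_commute[OF C c(1)])
    also have "\<dots> = l' c' *\<^sub>R (c \<odot> c')"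
      unfolding x' by (simp add: idem_system_mul_sum[OF C' c(2)] mul_simps)
    finally show ?thesis using c(3) by (simp add: comm[of c' c])
  qed
  have "(\<Sum>c\<in>C. h (l c) *\<^sub>R c) = (\<Sum>c\<in>C. h (l c) *\<^sub>R (c \<odot> \<Sum>C'))"
    by (simp add: idem_systemD[OF C'])
  also have "\<dots> = (\<Sum>c\<in>C. \<Sum>c'\<in>C'. h (l c) *\<^sub>R (c \<odot> c'))" by (simp add: mul.sum_right scaleR_sum_right)
  also have "\<dots> = (\<Sum>c\<in>C. \<Sum>c'\<in>C'. h (l' c') *\<^sub>R (c \<odot> c'))"
    using orth by (intro sum.cong) (metis scaleR_zero_right)+
  also have "\<dots> = (\<Sum>c'\<in>C'. \<Sum>c\<in>C. h (l' c') *\<^sub>R (c \<odot> c'))" by (rule sum.swap)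
  also have "\<dots> = (\<Sum>c'\<in>C'. h (l' c') *\<^sub>R (\<Sum>C \<odot> c'))" by (simp add: mul.sum_left scaleR_sum_right)
  finally show ?thesis by (simp add: idem_systemD[OF C])
qed

text \<open>The idempotents \<open>c\<close> occurring in \<open>y\<close> with nonzero eigenvalue
  stay in the Peirce 1-space of \<open>b\<close>, a subalgebra with unit \<open>b\<close>. There
  \<open>b = c + (b - c)\<close> is a sum of idempotents, and primitivity forces
  \<open>c = b\<close>.\<close>

lemma primitive_eigenspace:
  assumes b: "primitive_idempotent mul b" and y: "b \<odot> y = y"
  obtains t where "y = t *\<^sub>R b"
proof -
  have bb: "b \<odot> b = b" using b by (simp add: primitive_idempotent_def)
  let ?S = "{z. b \<odot> z = z}"
  obtain C l where C: "idem_system C" "y = (\<Sum>c\<in>C. l c *\<^sub>R c)"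
    and cl: "\<forall>S. subspace S \<and> y \<in> S \<and> (\<forall>y\<in>S. \<forall>z\<in>S. y \<odot> z \<in> S) \<longrightarrow> (\<forall>c\<in>C. l c \<noteq> 0 \<longrightarrow> c \<in> S)"
    by (rule idem_spectral)
  have sub: "subspace ?S" by (auto simp: subspace_def mul_simps)
  have closed: "y \<odot> z \<in> ?S" if "y \<in> ?S" "z \<in> ?S" for y z using that commute_1[OF bb, of y z] by simp
  have eqb: "c = b" if c: "c \<in> C" "l c \<noteq> 0" for c
  proof -
    have "c \<in> ?S" using cl[rule_format, of ?S c] sub y closed c by blast
    then have bc: "b \<odot> c = c" by simp
    have cc: "c \<noteq> 0" "c \<odot> c = c" using idem_systemD[OF C(1)] c(1) by auto
    have "(b - c) \<odot> (b - c) = b - c" by (simp add: mul_simps bb bc cc comm[of c b])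
    moreover have "b = c + (b - c)" by simp
    ultimately have "b - c = 0" using b cc unfolding primitive_idempotent_def by blast
    then show ?thesis by simp
  qed
  have "y = (\<Sum>c\<in>C. (if c = b then l b *\<^sub>R b else 0))" unfolding C(2) using eqb by (intro sum.cong) auto
  also have "\<dots> = (if b \<in> C then l b else 0) *\<^sub>R b" using idem_systemD(1)[OF C(1)] by simp
  finally show ?thesis by (rule that)
qed

section \<open>Pairs of primitive idempotents\<close>

lemma primitiveD: "primitive_idempotent mul c \<Longrightarrow> c \<odot> c = c" "primitive_idempotent mul c \<Longrightarrow> 0 < c \<bullet> c"
  by (simp_all add: primitive_idempotent_def)

text \<open>\<open>P a\<close> maps into the Peirce 1-space of \<open>a\<close>, which is the line
  through \<open>a\<close>; pairing with \<open>a\<close> determines the coefficient.\<close>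

lemma primitive_mul_mul:
  assumes a: "primitive_idempotent mul a"
  shows "a \<odot> (a \<odot> b) = (1/2) *\<^sub>R (a \<odot> b + ((a \<bullet> b) / (a \<bullet> a)) *\<^sub>R a)"
proof -
  note D = primitiveD[OF a]
  have "a \<odot> P a b = P a b"
    using idem_cubic[OF D(1), of b] by (simp add: P_eq D mul_simps algebra_simps scaleR_2 scaleR_3)
  then obtain t where t: "P a b = t *\<^sub>R a" using primitive_eigenspace[OF a] by blast
  have "P a b \<bullet> a = b \<bullet> a" by (simp add: P_eq D inner_diff_left adj)
  then have "t = (a \<bullet> b) / (a \<bullet> a)" using D by (simp add: t field_simps inner_commute)
  with t have "2 *\<^sub>R (a \<odot> (a \<odot> b)) = a \<odot> b + ((a \<bullet> b) / (a \<bullet> a)) *\<^sub>R a" by (simp add: P_eq D algebra_simps)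
  then have "(1/2) *\<^sub>R (2 *\<^sub>R (a \<odot> (a \<odot> b))) = (1/2) *\<^sub>R (a \<odot> b + ((a \<bullet> b) / (a \<bullet> a)) *\<^sub>R a)" by simp
  then show ?thesis by simp
qed

lemma primitive_inner:
  assumes a: "a \<odot> a = a" and b: "primitive_idempotent mul b"
  shows "(a \<odot> b) \<bullet> (a \<odot> b) = (1 + (a \<bullet> b) / (b \<bullet> b)) * (a \<bullet> b) / 2"
proof -
  have "(a \<odot> b) \<bullet> (a \<odot> b) = a \<bullet> (b \<odot> (b \<odot> a))" by (simp add: inner_assoc comm)
  also have "\<dots> = (a \<bullet> (b \<odot> a) + (a \<bullet> b) / (b \<bullet> b) * (a \<bullet> b)) / 2"
    by (simp add: primitive_mul_mul[OF b] inner_add_right inner_commute)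
  also have "a \<bullet> (b \<odot> a) = a \<bullet> b" using a by (metis adj comm)
  finally show ?thesis by (simp add: algebra_simps)
qed

text \<open>\<open>primitive_inner\<close> computes the squared norm of \<open>a \<odot> b\<close>
  twice, once with \<open>b \<bullet> b\<close> and once with \<open>a \<bullet> a\<close> in the
  denominator.\<close>

lemma primitive_norm_eq:
  assumes a: "primitive_idempotent mul a" and b: "primitive_idempotent mul b" and "a \<bullet> b \<noteq> 0"
  shows "a \<bullet> a = b \<bullet> b"
  using primitive_inner[OF primitiveD(1)[OF a] b] primitive_inner[OF primitiveD(1)[OF b] a] assms(3)
    primitiveD(2)[OF a] primitiveD(2)[OF b]
  by (simp add: comm[of b a] inner_commute[of b a] field_simps)

lemma primitive_orth:
  assumes "a \<odot> a = a" "primitive_idempotent mul b" "a \<bullet> b = 0"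
  shows "a \<odot> b = 0"
  using primitive_inner[OF assms(1,2)] assms(3) by simp

text \<open>Together with \<open>primitive_mul_mul\<close> this completes the multiplication table
  of the span of \<open>a\<close>, \<open>b\<close> and \<open>a \<odot> b\<close>, so all
  computations with the pair take place in that subalgebra.\<close>

lemma primitive_square:
  assumes a: "primitive_idempotent mul a" and b: "primitive_idempotent mul b"
    and eq: "a \<bullet> a = b \<bullet> b"
  shows "(a \<odot> b) \<odot> (a \<odot> b) = ((a \<bullet> b) / (a \<bullet> a) / 4) *\<^sub>R (a + b + 2 *\<^sub>R (a \<odot> b))"
proof -
  define w t where "w = a \<odot> b" and "t = (a \<bullet> b) / (a \<bullet> a)"
  have aw: "a \<odot> w = (1/2) *\<^sub>R (w + t *\<^sub>R a)" unfolding w_def t_def by (rule primitive_mul_mul[OF a])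
  have bw: "b \<odot> w = (1/2) *\<^sub>R (w + t *\<^sub>R b)"
    unfolding w_def t_def using primitive_mul_mul[OF b, of a] by (simp add: comm[of b a] inner_commute eq)
  note D = primitiveD(1)[OF a] primitiveD(1)[OF b]
  have "w \<odot> w + w \<odot> w = a \<odot> (b \<odot> w) + a \<odot> (b \<odot> w) + b \<odot> w - w"
    using jordan_linearized[of a a b b] by (simp add: D comm[of b a] comm[of w b] algebra_simps flip: w_def)
  moreover have "a \<odot> (b \<odot> w) = (1/4) *\<^sub>R (w + t *\<^sub>R a) + (t/2) *\<^sub>R w"
    by (simp add: bw mul_simps aw scaleR_add_right flip: w_def)
  ultimately have "w \<odot> w + w \<odot> w = (1/4) *\<^sub>R (w + t *\<^sub>R a) + (t/2) *\<^sub>R w + ((1/4) *\<^sub>R (w + t *\<^sub>R a) + (t/2) *\<^sub>R w)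
      + (1/2) *\<^sub>R (w + t *\<^sub>R b) - w" (is "_ = ?r") by (simp only: bw)
  \<comment> \<open>Pairing with an arbitrary vector turns the identity into one over the reals,
    where fractional coefficients can be collected. The same device recurs below through
    \<open>vector_eq_rdot\<close>.\<close>
  then have inner: "(w \<odot> w) \<bullet> z + (w \<odot> w) \<bullet> z = ?r \<bullet> z" for z by (metis inner_add_left)
  have "(w \<odot> w) \<bullet> z = ((t / 4) *\<^sub>R (a + b + 2 *\<^sub>R w)) \<bullet> z" for z
    using inner[of z] by (simp add: inner_add_left inner_diff_left field_simps)
  then have "w \<odot> w = (t / 4) *\<^sub>R (a + b + 2 *\<^sub>R w)" using vector_eq_rdot by blast
  then show ?thesis by (simp only: w_def t_def)
qed

end

section \<open>Simplicity and the cone\<close>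

context eja begin

text \<open>The \<open>S\<close> component of \<open>e\<close> is the unit. Annihilating elements
  are orthogonal, so the \<open>S'\<close> component of a product of two elements of
  \<open>S\<close> is orthogonal to itself and vanishes.\<close>

lemma factor_algebra:
  assumes S: "subspace S" and S': "subspace S'"
    and orth: "\<And>x y. x \<in> S \<Longrightarrow> y \<in> S' \<Longrightarrow> x \<odot> y = 0"
    and decomp: "\<And>x. \<exists>s\<in>S. \<exists>s'\<in>S'. x = s + s'"
  obtains e' where "euclidean_jordan_algebra S mul e'"
proof -
  obtain e1 e2 where e: "e1 \<in> S" "e2 \<in> S'" "e = e1 + e2" using decomp by blast
  have inner0: "s \<bullet> s' = 0" if "s \<in> S" "s' \<in> S'" for s s'
    using orth[OF that] by (metis adj inner_zero_left unit_right inner_commute)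
  have "x \<odot> y \<in> S" if xy: "x \<in> S" "y \<in> S" for x y
  proof -
    obtain s s' where s: "s \<in> S" "s' \<in> S'" "x \<odot> y = s + s'" using decomp by blast
    have "(x \<odot> y) \<bullet> s' = 0" using orth[OF xy(2) s(2)] by (simp flip: inner_assoc)
    then have "s' \<bullet> s' = 0" using s inner0[OF s(1,2)] by (simp add: inner_add_left)
    then show ?thesis using s by simp
  qed
  moreover have "x \<odot> e1 = x" if "x \<in> S" for x
    using orth[OF that e(2)] unit_right[of x] unfolding e(3) by (simp add: mul_simps)
  ultimately have "euclidean_jordan_algebra S mul e1"
    unfolding euclidean_jordan_algebra_def using S e(1)
    by (auto simp: mul_simps jordan inner_assoc intro: comm)
  then show ?thesis by (rule that)
qed

text \<open>An induction principle along non-orthogonal pairs. If it failed, the primitive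
  idempotents with \<open>Q\<close> and those without would annihilate each other, and by
  \<open>spectral\<close> their spans would exhibit the algebra as a product.\<close>

lemma primitive_connected:
  assumes simple: "\<not> is_jordan_product mul"
    and a: "primitive_idempotent mul a" "Q a"
    and step: "\<And>x y. primitive_idempotent mul x \<Longrightarrow> primitive_idempotent mul y \<Longrightarrow> x \<bullet> y \<noteq> 0 \<Longrightarrow> Q x \<Longrightarrow> Q y"
    and b: "primitive_idempotent mul b"
  shows "Q b"
proof (rule ccontr)
  assume nb: "\<not> Q b"
  define P1 P2 where "P1 = {x. primitive_idempotent mul x \<and> Q x}" and "P2 = {x. primitive_idempotent mul x \<and> \<not> Q x}"
  have orth12: "x \<odot> y = 0" if "x \<in> P1" "y \<in> P2" for x y
    using that step[of x y] primitive_orth[of x y] primitiveD(1)[of x] by (auto simp: P1_def P2_def)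
  have orth1: "x \<odot> y = 0" if "x \<in> P1" "y \<in> span P2" for x y
    using that(2) by (induction rule: span_induct_alt) (auto simp: mul_simps orth12 that(1))
  have orth: "x \<odot> y = 0" if "x \<in> span P1" "y \<in> span P2" for x y
    using that(1) by (induction rule: span_induct_alt) (auto simp: mul_simps orth1 that(2))
  have decomp: "\<exists>s\<in>span P1. \<exists>s'\<in>span P2. x = s + s'" for x
  proof -
    obtain C l where C: "complete_system mul e C" and x: "x = (\<Sum>c\<in>C. l c *\<^sub>R c)" using spectral .
    have "finite C" and prim: "\<And>c. c \<in> C \<Longrightarrow> primitive_idempotent mul c"
      using C by (auto simp: complete_system_def)
    then have "x = (\<Sum>c\<in>C \<inter> {c. Q c}. l c *\<^sub>R c) + (\<Sum>c\<in>C \<inter> - {c. Q c}. l c *\<^sub>R c)"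
      unfolding x by (subst sum.union_disjoint[symmetric]) (auto intro!: sum.cong)
    moreover have "(\<Sum>c\<in>C \<inter> {c. Q c}. l c *\<^sub>R c) \<in> span P1"
      using prim by (intro span_sum span_scale span_base) (auto simp: P1_def)
    moreover have "(\<Sum>c\<in>C \<inter> - {c. Q c}. l c *\<^sub>R c) \<in> span P2"
      using prim by (intro span_sum span_scale span_base) (auto simp: P2_def)
    ultimately show ?thesis by blast
  qed
  obtain e1 where e1: "euclidean_jordan_algebra (span P1) mul e1"
    by (rule factor_algebra[OF _ _ orth decomp]) auto
  have orth': "y \<odot> x = 0" if "y \<in> span P2" "x \<in> span P1" for x y using orth[OF that(2,1)] by (simp add: comm)
  have decomp': "\<exists>s\<in>span P2. \<exists>s'\<in>span P1. x = s + s'" for x using decomp[of x] by (metis add.commute)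
  obtain e2 where e2: "euclidean_jordan_algebra (span P2) mul e2"
    by (rule factor_algebra[OF _ _ orth' decomp']) auto
  have inner0: "s \<bullet> s' = 0" if "s \<in> span P1" "s' \<in> span P2" for s s'
    using orth[OF that] by (metis adj inner_zero_left unit_right inner_commute)
  have "a \<in> P1" "b \<in> P2" using a b nb by (auto simp: P1_def P2_def)
  moreover have "a \<noteq> 0" "b \<noteq> 0" using a b by (auto simp: primitive_idempotent_def)
  ultimately have dims: "dim (span P1) > 0" "dim (span P2) > 0"
    by (metis dim_eq_0 gr0I singletonD span_base subset_iff)+
  define \<phi> where "\<phi> p = fst p + snd p" for p :: "'a \<times> 'a"
  have lin: "linear \<phi>" by (rule linearI) (simp_all add: \<phi>_def algebra_simps)
  have "inj_on \<phi> (span P1 \<times> span P2)"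
  proof (intro inj_onI; clarsimp simp: \<phi>_def)
    fix x1 x2 y1 y2 assume h: "x1 \<in> span P1" "x2 \<in> span P2" "y1 \<in> span P1" "y2 \<in> span P2" "x1 + x2 = y1 + y2"
    then have eq: "x1 - y1 = y2 - x2" by (simp add: algebra_simps)
    have "(x1 - y1) \<bullet> (y2 - x2) = 0" using h by (intro inner0 span_diff)
    then have "x1 - y1 = 0" by (simp add: eq)
    then show "x1 = y1 \<and> x2 = y2" using eq by simp
  qed
  moreover have "\<phi> ` (span P1 \<times> span P2) = UNIV"
    using decomp by (fastforce simp: \<phi>_def image_iff)
  ultimately have "bij_betw \<phi> (span P1 \<times> span P2) UNIV" by (simp add: bij_betw_def)
  moreover have "\<forall>x1\<in>span P1. \<forall>x2\<in>span P2. \<forall>y1\<in>span P1. \<forall>y2\<in>span P2.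
           \<phi> (mul x1 y1, mul x2 y2) = mul (\<phi> (x1, x2)) (\<phi> (y1, y2))"
    using orth orth' by (simp add: \<phi>_def mul_simps)
  ultimately have "is_jordan_product mul"
    unfolding is_jordan_product_def using e1 e2 dims lin by blast
  then show False using simple by contradiction
qed

text \<open>Positive semidefiniteness of multiplication by \<open>x\<close>, a condition that is
  visibly closed under sums. By \<open>nonneg_iff_square\<close> it describes the squares, and by
  \<open>symmetric_cone_eq\<close> \<open>pos\<close> describes the symmetric cone.\<close>

definition nonneg :: "'a \<Rightarrow> bool" where "nonneg x \<longleftrightarrow> (\<forall>v. 0 \<le> (x \<odot> v) \<bullet> v)"
definition pos :: "'a \<Rightarrow> bool" where "pos x \<longleftrightarrow> (\<exists>m>0. nonneg (x - m *\<^sub>R e))"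

lemma nonneg_0: "nonneg 0" and nonneg_add: "nonneg x \<Longrightarrow> nonneg y \<Longrightarrow> nonneg (x + y)"
  and nonneg_scale: "0 \<le> t \<Longrightarrow> nonneg x \<Longrightarrow> nonneg (t *\<^sub>R x)"
  and nonneg_idem: "c \<odot> c = c \<Longrightarrow> nonneg c"
  by (auto simp: nonneg_def mul_simps inner_add_left idem_psd)

lemma nonneg_sum: "(\<And>i. i \<in> A \<Longrightarrow> nonneg (g i)) \<Longrightarrow> nonneg (sum g A)"
  by (induction A rule: infinite_finite_induct) (auto simp: nonneg_0 nonneg_add)

lemma pos_add_nonneg: "pos x \<Longrightarrow> nonneg y \<Longrightarrow> pos (x + y)"
  unfolding pos_def by (metis add_diff_eq add.commute nonneg_add[of "_ - _"])

lemma pos_imp_nonneg: "pos x \<Longrightarrow> nonneg x"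
proof -
  assume "pos x"
  then obtain m where "m > 0" "nonneg (x - m *\<^sub>R e)" by (auto simp: pos_def)
  then have "nonneg (x - m *\<^sub>R e + m *\<^sub>R e)" by (intro nonneg_add nonneg_scale nonneg_idem[of e]) auto
  then show ?thesis by simp
qed

lemma pos_add: "pos x \<Longrightarrow> pos y \<Longrightarrow> pos (x + y)"
  by (simp add: pos_add_nonneg pos_imp_nonneg)

lemma pos_scale: "pos x \<Longrightarrow> 0 < t \<Longrightarrow> pos (t *\<^sub>R x)"
proof -
  assume "pos x" and t: "0 < t"
  then obtain m where m: "m > 0" "nonneg (x - m *\<^sub>R e)" by (auto simp: pos_def)
  have "nonneg (t *\<^sub>R x - (t * m) *\<^sub>R e)" using nonneg_scale[of t, OF _ m(2)] t by (simp add: algebra_simps)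
  then show ?thesis unfolding pos_def using t m(1) by (intro exI[of _ "t * m"]) simp
qed

lemma pos_e: "pos e"
  unfolding pos_def by (intro exI[of _ 1]) (simp add: nonneg_0)

lemma idem_system_sum_diff:
  assumes "idem_system C"
  shows "(\<Sum>c\<in>C. l c *\<^sub>R c) - t *\<^sub>R e = (\<Sum>c\<in>C. (l c - t) *\<^sub>R c)"
proof -
  have "t *\<^sub>R e = (\<Sum>c\<in>C. t *\<^sub>R c)"
    by (simp only: scaleR_sum_right[symmetric] idem_systemD(2)[OF assms])
  then show ?thesis by (simp add: sum_subtractf scaleR_diff_left)
qed

lemma nonneg_spectral_iff:
  assumes C: "idem_system C"
  shows "nonneg (\<Sum>c\<in>C. l c *\<^sub>R c) \<longleftrightarrow> (\<forall>c\<in>C. 0 \<le> l c)"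
proof
  assume nn: "nonneg (\<Sum>c\<in>C. l c *\<^sub>R c)"
  show "\<forall>c\<in>C. 0 \<le> l c"
  proof
    fix c assume c: "c \<in> C"
    then have "0 \<le> l c * (c \<bullet> c)"
      using nn idem_system_mul_sum[OF C c, of l] unfolding nonneg_def by (metis inner_scaleR_left)
    then show "0 \<le> l c" using idem_systemD(3)[OF C c] mult_le_cancel_right_pos[of "c \<bullet> c" 0 "l c"] by simp
  qed
next
  assume "\<forall>c\<in>C. 0 \<le> l c"
  then show "nonneg (\<Sum>c\<in>C. l c *\<^sub>R c)"
    by (intro nonneg_sum nonneg_scale nonneg_idem[OF idem_systemD(4)[OF C]]) auto
qed

lemma pos_spectral_iff:
  assumes C: "idem_system C"
  shows "pos (\<Sum>c\<in>C. l c *\<^sub>R c) \<longleftrightarrow> (\<forall>c\<in>C. 0 < l c)"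
proof
  assume "pos (\<Sum>c\<in>C. l c *\<^sub>R c)"
  then show "\<forall>c\<in>C. 0 < l c"
    unfolding pos_def idem_system_sum_diff[OF C] nonneg_spectral_iff[OF C] by force
next
  assume l: "\<forall>c\<in>C. 0 < l c"
  \<comment> \<open>The extra 1 gives \<open>Min\<close> a nonempty set even for empty
    \<open>C\<close>.\<close>
  define m where "m = Min (insert 1 (l ` C))"
  have fin: "finite (insert 1 (l ` C))" using idem_systemD(1)[OF C] by simp
  have "m \<in> insert 1 (l ` C)" unfolding m_def using fin by (intro Min_in) auto
  then have "m > 0" using l by auto
  moreover have "m \<le> l c" if "c \<in> C" for c unfolding m_def using fin that by (intro Min_le) auto
  ultimately show "pos (\<Sum>c\<in>C. l c *\<^sub>R c)"
    unfolding pos_def idem_system_sum_diff[OF C] nonneg_spectral_iff[OF C] by force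
qed

lemma idem_system_mul:
  assumes C: "idem_system C"
  shows "(\<Sum>c\<in>C. l c *\<^sub>R c) \<odot> (\<Sum>c\<in>C. k c *\<^sub>R c) = (\<Sum>c\<in>C. (l c * k c) *\<^sub>R c)"
  unfolding mul.sum_right[of _ _ C] using idem_system_mul_sum[OF C, of _ l]
  by (intro sum.cong) (auto simp: mul_simps mult.commute)

lemma nonneg_iff_square: "nonneg x \<longleftrightarrow> (\<exists>y. x = y \<odot> y)"
proof
  assume nn: "nonneg x"
  obtain C l where "complete_system mul e C" and x: "x = (\<Sum>c\<in>C. l c *\<^sub>R c)" using spectral .
  then have C: "idem_system C" by (simp add: complete_system_iff)
  have "\<forall>c\<in>C. 0 \<le> l c" using nn unfolding x nonneg_spectral_iff[OF C] .
  then have "x = (\<Sum>c\<in>C. sqrt (l c) *\<^sub>R c) \<odot> (\<Sum>c\<in>C. sqrt (l c) *\<^sub>R c)"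
    unfolding x idem_system_mul[OF C] by (intro sum.cong) auto
  then show "\<exists>y. x = y \<odot> y" by blast
next
  assume "\<exists>y. x = y \<odot> y"
  then obtain y where y: "x = y \<odot> y" ..
  obtain C l where "complete_system mul e C" and yl: "y = (\<Sum>c\<in>C. l c *\<^sub>R c)" using spectral .
  then have C: "idem_system C" by (simp add: complete_system_iff)
  show "nonneg x" unfolding y yl idem_system_mul[OF C] nonneg_spectral_iff[OF C] by simp
qed

text \<open>Multiplication is bounded, so a perturbation of size below m / (2 K) uses up at most
  half of the margin \<open>m\<close>.\<close>

lemma open_pos: "open {x. pos x}"
proof -
  obtain K where K: "K > 0" "\<And>a b. norm (a \<odot> b) \<le> norm a * norm b * K" using mul.pos_bounded by blast
  show ?thesis unfolding open_contains_ball
  proof clarify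
    fix x assume "pos x"
    then obtain m where m: "m > 0" "nonneg (x - m *\<^sub>R e)" by (auto simp: pos_def)
    have "pos y" if y: "y \<in> ball x (m / (2 * K))" for y
    proof -
      have "nonneg (y - (m/2) *\<^sub>R e)" unfolding nonneg_def
      proof
        fix v
        have "norm ((x - y) \<odot> v) \<le> norm (x - y) * norm v * K" by (rule K)
        also have "\<dots> \<le> (m / (2 * K)) * norm v * K"
          using y K(1) by (intro mult_right_mono) (auto simp: dist_norm)
        also have "\<dots> = m / 2 * norm v" using K(1) by simp
        finally have 1: "norm ((x - y) \<odot> v) * norm v \<le> m / 2 * norm v * norm v" by (rule mult_right_mono) simp
        have "((x - y) \<odot> v) \<bullet> v \<le> norm ((x - y) \<odot> v) * norm v" by (rule norm_cauchy_schwarz)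
        with 1 have "((x - y) \<odot> v) \<bullet> v \<le> m / 2 * (v \<bullet> v)"
          by (simp add: power2_norm_eq_inner[symmetric] power2_eq_square)
        moreover have "0 \<le> ((x - m *\<^sub>R e) \<odot> v) \<bullet> v" using m(2) by (simp add: nonneg_def)
        ultimately show "0 \<le> ((y - (m/2) *\<^sub>R e) \<odot> v) \<bullet> v" by (simp add: mul_simps inner_diff_left)
      qed
      then show ?thesis unfolding pos_def using m(1) half_gt_zero by blast
    qed
    then show "\<exists>\<epsilon>>0. ball x \<epsilon> \<subseteq> {x. pos x}" using m(1) K(1)
      by (intro exI[of _ "m / (2 * K)"]) auto
  qed
qed

lemma symmetric_cone_eq: "symmetric_cone mul = {x. pos x}"
proof
  have sq: "{y \<odot> y |y. True} = {x. nonneg x}" using nonneg_iff_square by blast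
  show "{x. pos x} \<subseteq> symmetric_cone mul"
    unfolding symmetric_cone_def sq by (rule interior_maximal[OF _ open_pos]) (auto simp: pos_imp_nonneg)
  show "symmetric_cone mul \<subseteq> {x. pos x}"
  proof
    fix x assume "x \<in> symmetric_cone mul"
    then obtain d where d: "d > 0" "cball x d \<subseteq> {x. nonneg x}"
      unfolding symmetric_cone_def sq mem_interior_cball by blast
    \<comment> \<open>From an interior point one can move along \<open>- e\<close> and stay among
      the squares; the length of the move is the margin that \<open>pos\<close> asks for. The
      \<open>+ 1\<close> keeps the denominator positive.\<close>
    define t where "t = d / (norm e + 1)"
    have pos1: "norm e + 1 > 0" by (simp add: add_nonneg_pos)
    have "t > 0" using d(1) pos1 by (simp add: t_def)
    have "t * norm e \<le> t * (norm e + 1)" using \<open>t > 0\<close> by simp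
    also have "\<dots> = d" using pos1 by (simp add: t_def)
    finally have "norm (t *\<^sub>R e) \<le> d" using \<open>t > 0\<close> by simp
    then have "x - t *\<^sub>R e \<in> cball x d" by (simp add: dist_norm)
    then have "nonneg (x - t *\<^sub>R e)" using d(2) by blast
    then show "x \<in> {x. pos x}" unfolding pos_def using \<open>t > 0\<close> by blast
  qed
qed

section \<open>The quadratic representation preserves the cone\<close>

lemma linear_P: "linear (P y)"
  by (rule linearI) (simp_all add: P_eq mul_simps algebra_simps)

lemma P_unit_plus: "P (e + y) v = v + 2 *\<^sub>R (y \<odot> v) + P y v"
  by (simp add: P_eq mul_simps algebra_simps scaleR_2)

lemma P_scale: "P (t *\<^sub>R y) v = t\<^sup>2 *\<^sub>R P y v"
  by (simp add: P_eq mul_simps power2_eq_square scaleR_diff_right)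

text \<open>Used to factor \<open>P y\<close>, for \<open>y\<close> written on a frame, into maps
  that change one eigenvalue each. The mixed terms match because \<open>P z v\<close> lies in the
  Peirce 0-space of \<open>c\<close> and \<open>z \<odot> (c \<odot> v)\<close> in its Peirce
  1/2-space.\<close>

lemma P_mult:
  assumes c: "c \<odot> c = c" and cz: "c \<odot> z = 0"
  shows "P (e + (r *\<^sub>R c + z)) v = P (e + r *\<^sub>R c) (P (e + z) v)"
proof -
  have zc: "z \<odot> c = 0" using cz by (simp add: comm)
  have comm_c: "c \<odot> (z \<odot> u) = z \<odot> (c \<odot> u)" for u by (rule commute_0[OF c cz])
  have czz: "c \<odot> (z \<odot> z) = 0" using comm_c[of z] cz by simp
  have cP: "c \<odot> P z v = 0"
  proof -
    have "0 = c \<odot> (z \<odot> z \<odot> v) - 2 *\<^sub>R (z \<odot> (c \<odot> (z \<odot> v)))"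
      using mul_triple[of c z z v] by (simp add: czz cz zc scaleR_2 algebra_simps)
    then show ?thesis by (simp add: P_eq mul_simps comm_c)
  qed
  have zcv: "z \<odot> (c \<odot> v) = 2 *\<^sub>R (c \<odot> (z \<odot> (c \<odot> v)))"
    using mul_triple[of z c c v] by (simp add: c cz zc scaleR_2 algebra_simps)
  define A B where "A = z \<odot> (c \<odot> v)" and "B = P z v"
  have cA: "2 *\<^sub>R (c \<odot> A) = A" using zcv by (simp add: A_def)
  have czv: "c \<odot> (z \<odot> v) = A" by (simp add: A_def comm_c)
  have u: "P (e + z) v = v + 2 *\<^sub>R (z \<odot> v) + B" by (simp add: P_unit_plus B_def)
  define U where "U = P (e + z) v"
  have cu: "c \<odot> U = c \<odot> v + 2 *\<^sub>R A" by (simp add: U_def u mul_simps czv B_def cP)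
  have "P c U = P c v" by (simp add: P_eq c cu mul_simps cA algebra_simps)
  then have rhs: "P (e + r *\<^sub>R c) U = v + 2 *\<^sub>R (z \<odot> v) + B + (2 * r) *\<^sub>R (c \<odot> v + 2 *\<^sub>R A) + r\<^sup>2 *\<^sub>R P c v"
    by (simp add: P_unit_plus[of "r *\<^sub>R c"] P_scale mul_simps cu) (simp add: U_def u)
  have "r * 4 = r * 2 + r * 2" by simp
  then have four: "(r * 4) *\<^sub>R A = (r * 2) *\<^sub>R A + (r * 2) *\<^sub>R A" by (simp only: scaleR_add_left)
  have "P (r *\<^sub>R c + z) v = r\<^sup>2 *\<^sub>R P c v + (r * 4) *\<^sub>R A + B"
    unfolding four
    by (simp add: P_eq mul_simps c cz zc czv A_def[symmetric] B_def power2_eq_square algebra_simps)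
  then show ?thesis unfolding U_def[symmetric] rhs P_unit_plus[of "r *\<^sub>R c + z"] four
    by (simp add: mul_simps algebra_simps four)
qed

text \<open>In the non-orthogonal case, think of 2 by 2 matrices: \<open>b\<close> projects onto a
  unit vector at squared cosine \<open>t\<close> to the range of \<open>c\<close>, and its image
  \<open>z\<close> is a rank-one matrix of trace \<open>s\<close>. Thus
  \<open>z \<odot> z = s z\<close> with \<open>s > 0\<close>, and \<open>z\<close> is a positive
  multiple of a square.\<close>

lemma P_primitive:
  assumes c: "primitive_idempotent mul c" and b: "primitive_idempotent mul b" and r: "-1 < r"
  shows "nonneg (P (e + r *\<^sub>R c) b)"
proof (cases "c \<bullet> b = 0")
  case True
  then have "c \<odot> b = 0" using primitive_orth primitiveD(1)[OF c] b by blast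
  then have "P (e + r *\<^sub>R c) b = b" by (simp add: P_eq mul_simps primitiveD[OF c] scaleR_2)
  then show ?thesis using nonneg_idem primitiveD(1)[OF b] by simp
next
  case False
  note D = primitiveD[OF c] primitiveD[OF b]
  have norm: "c \<bullet> c = b \<bullet> b" by (rule primitive_norm_eq[OF c b False])
  define w t where "w = c \<odot> b" and "t = (c \<bullet> b) / (c \<bullet> c)"
  have cw: "c \<odot> w = (1/2) *\<^sub>R (w + t *\<^sub>R c)" unfolding w_def t_def by (rule primitive_mul_mul[OF c])
  have bw: "b \<odot> w = (1/2) *\<^sub>R (w + t *\<^sub>R b)"
    unfolding w_def t_def using primitive_mul_mul[OF b, of c] by (simp add: comm[of b c] inner_commute norm)
  have ww: "w \<odot> w = (t/4) *\<^sub>R (c + b + 2 *\<^sub>R w)"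
    unfolding w_def t_def by (rule primitive_square[OF c b norm])
  define z where "z = b + (2 * r) *\<^sub>R w + (r\<^sup>2 * t) *\<^sub>R c"
  have Pz: "P (e + r *\<^sub>R c) b = z"
    by (simp add: P_unit_plus P_scale z_def mul_simps) (simp add: P_eq D cw flip: w_def)
  define s where "s = 1 - t + t * (1 + r)\<^sup>2"
  have "z \<odot> z = s *\<^sub>R z"
  proof -
    have "(z \<odot> z) \<bullet> u = (s *\<^sub>R z) \<bullet> u" for u
      unfolding z_def s_def
      by (simp add: mul_simps D cw bw ww comm[of w b] comm[of w c] comm[of b c] inner_add_left w_def[symmetric])
        (simp add: power2_eq_square field_simps)
    then show ?thesis using vector_eq_rdot by blast
  qed
  \<comment> \<open>\<open>s\<close> is a convex combination of 1 and (1 + r)^2: \<open>t\<close>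
    lies between 0 and 1 because idempotents are nonnegative and \<open>c\<close>, \<open>b\<close>
    have equal norm.\<close>
  moreover have "s > 0"
  proof -
    have "c \<bullet> b = (c \<odot> b) \<bullet> b" using inner_assoc[of c b b] D by simp
    then have "c \<bullet> b \<ge> 0" using idem_psd[OF D(1), of b] by simp
    then have "t \<ge> 0" using D by (simp add: t_def)
    have "0 \<le> (c - b) \<bullet> (c - b)" by simp
    then have "c \<bullet> b \<le> c \<bullet> c" using norm by (simp add: inner_diff_left inner_diff_right inner_commute)
    then have "t \<le> 1" using D by (simp add: t_def)
    have r0: "(1 + r)\<^sup>2 > 0" using r by simp
    show ?thesis
    proof (cases "t = 0")
      case False
      then have "t * (1 + r)\<^sup>2 > 0" using r0 \<open>t \<ge> 0\<close> by simp
      then show ?thesis using \<open>t \<le> 1\<close> by (simp add: s_def)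
    qed (simp add: s_def)
  qed
  ultimately have "z = (1 / s) *\<^sub>R (z \<odot> z)" by simp
  then show ?thesis unfolding Pz using nonneg_scale[of "1/s" "z \<odot> z"] nonneg_iff_square \<open>s > 0\<close> by (metis less_imp_le zero_less_divide_1_iff)
qed

text \<open>\<open>P_mult\<close> peels off the eigenvalues of \<open>y\<close> one by one; each
  factor keeps primitive idempotents nonnegative, hence by \<open>spectral\<close> every nonnegative
  element.\<close>

lemma P_nonneg:
  assumes "pos y" "nonneg x"
  shows "nonneg (P y x)"
proof -
  obtain C l where CS: "complete_system mul e C" and y: "y = (\<Sum>c\<in>C. l c *\<^sub>R c)" using spectral .
  then have C: "idem_system C" and prim: "\<And>c. c \<in> C \<Longrightarrow> primitive_idempotent mul c" by (auto simp: complete_system_iff)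
  note D = idem_systemD[OF C]
  have l: "\<forall>c\<in>C. 0 < l c" using assms(1) unfolding y pos_spectral_iff[OF C] .
  have step: "nonneg (P (e + r *\<^sub>R c) x)" if c: "c \<in> C" and r: "-1 < r" and "nonneg x" for c r x
  proof -
    obtain B k where B: "complete_system mul e B" and x: "x = (\<Sum>b\<in>B. k b *\<^sub>R b)" using spectral .
    then have "\<forall>b\<in>B. 0 \<le> k b" using \<open>nonneg x\<close> nonneg_spectral_iff complete_system_iff by blast
    moreover have "P (e + r *\<^sub>R c) x = (\<Sum>b\<in>B. k b *\<^sub>R P (e + r *\<^sub>R c) b)"
      unfolding x by (simp add: linear_sum[OF linear_P] linear_scale[OF linear_P])
    ultimately show ?thesis using B P_primitive[OF prim[OF c] _ r]
      by (auto simp: complete_system_iff intro!: nonneg_sum nonneg_scale)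
  qed
  have "nonneg (P (e + (\<Sum>c\<in>F. (l c - 1) *\<^sub>R c)) x)" if "F \<subseteq> C" for F
    using finite_subset[OF that D(1)] that
  proof (induction F rule: finite_induct)
    case empty then show ?case using assms(2) by (simp add: P_eq scaleR_2)
  next
    case (insert c F)
    have "c \<odot> (\<Sum>c\<in>F. (l c - 1) *\<^sub>R c) = 0"
      unfolding mul.sum_right using insert D(5) by (intro sum.neutral) (auto simp: mul_simps)
    moreover have "(\<Sum>c\<in>insert c F. (l c - 1) *\<^sub>R c) = (l c - 1) *\<^sub>R c + (\<Sum>c\<in>F. (l c - 1) *\<^sub>R c)"
      using insert by simp
    ultimately have "P (e + (\<Sum>c\<in>insert c F. (l c - 1) *\<^sub>R c)) x = P (e + (l c - 1) *\<^sub>R c) (P (e + (\<Sum>c\<in>F. (l c - 1) *\<^sub>R c)) x)"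
      using P_mult[of c] D(4)[of c] insert.prems by auto
    then show ?case using step[of c "l c - 1"] insert l by simp
  qed
  moreover have "e + (\<Sum>c\<in>C. (l c - 1) *\<^sub>R c) = y"
    using idem_system_sum_diff[OF C, of l 1] by (simp add: y algebra_simps)
  ultimately show ?thesis by (metis order_refl)
qed

lemma P_pos:
  assumes y: "pos y" and x: "pos x"
  shows "pos (P y x)"
proof -
  obtain m where m: "m > 0" "nonneg (x - m *\<^sub>R e)" using x by (auto simp: pos_def)
  obtain C l where "complete_system mul e C" and yl: "y = (\<Sum>c\<in>C. l c *\<^sub>R c)" using spectral .
  then have C: "idem_system C" by (simp add: complete_system_iff)
  have "\<forall>c\<in>C. 0 < l c" using y unfolding yl pos_spectral_iff[OF C] .
  then have "pos (y \<odot> y)" unfolding yl idem_system_mul[OF C] pos_spectral_iff[OF C] by simp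
  then have "pos (m *\<^sub>R (y \<odot> y) + P y (x - m *\<^sub>R e))"
    using m y by (intro pos_add_nonneg pos_scale P_nonneg)
  moreover have "P y e = y \<odot> y" by (simp add: P_eq algebra_simps scaleR_2)
  ultimately show ?thesis by (simp add: linear_diff[OF linear_P] linear_scale[OF linear_P])
qed

end

section \<open>Determinant and inverse square root\<close>

locale simple_eja = eja +
  assumes simple: "\<not> is_jordan_product mul"
begin

lemma primitive_norm_const:
  assumes "primitive_idempotent mul a" "primitive_idempotent mul b"
  shows "b \<bullet> b = a \<bullet> a"
  by (rule primitive_connected[OF simple assms(1) _ _ assms(2), where Q = "\<lambda>x. x \<bullet> x = a \<bullet> a"])
    (auto dest: primitive_norm_eq)

text \<open>The logarithm of \<open>x\<close> does not depend on the decomposition, and its pairing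
  with \<open>e\<close> is \<open>a \<bullet> a\<close> times the logarithm of the product of the
  eigenvalues, since all primitive idempotents have the norm of \<open>a\<close>.\<close>

lemma jordan_det_eq:
  assumes C: "complete_system mul e C" and l: "\<forall>c\<in>C. 0 < l c"
  shows "jordan_det mul e (\<Sum>c\<in>C. l c *\<^sub>R c) = (\<Prod>c\<in>C. l c)"
  unfolding jordan_det_def spectral_decomposition_def
proof (rule the_equality)
  show "\<exists>C' l'. (complete_system mul e C' \<and> (\<Sum>c\<in>C. l c *\<^sub>R c) = (\<Sum>c\<in>C'. l' c *\<^sub>R c)) \<and> prod l C = prod l' C'"
    using C by blast
next
  fix d assume "\<exists>C' l'. (complete_system mul e C' \<and> (\<Sum>c\<in>C. l c *\<^sub>R c) = (\<Sum>c\<in>C'. l' c *\<^sub>R c)) \<and> d = prod l' C'"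
  then obtain C' l' where C': "complete_system mul e C'" and eq: "(\<Sum>c\<in>C. l c *\<^sub>R c) = (\<Sum>c\<in>C'. l' c *\<^sub>R c)" and d: "d = prod l' C'"
    by blast
  have sys: "idem_system C" "idem_system C'" using C C' by (simp_all add: complete_system_iff)
  have l': "\<forall>c\<in>C'. 0 < l' c" using l pos_spectral_iff[OF sys(1), of l] pos_spectral_iff[OF sys(2), of l'] eq by simp
  show "d = prod l C"
  proof (cases "\<exists>a. primitive_idempotent mul a")
    case True
    then obtain a where a: "primitive_idempotent mul a" by blast
    have trace: "(\<Sum>c\<in>B. ln (k c) *\<^sub>R c) \<bullet> e = (a \<bullet> a) * ln (prod k B)"
      if B: "complete_system mul e B" and k: "\<forall>c\<in>B. 0 < k c" for B k
    proof -
      have "(\<Sum>c\<in>B. ln (k c) *\<^sub>R c) \<bullet> e = (\<Sum>c\<in>B. ln (k c) * (a \<bullet> a))"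
        unfolding inner_sum_left
      proof (rule sum.cong[OF refl])
        fix c assume "c \<in> B"
        then have c: "primitive_idempotent mul c" using B by (simp add: complete_system_iff)
        have "c \<bullet> e = c \<bullet> c" using inner_assoc[of c c e] primitiveD(1)[OF c] by simp
        then show "(ln (k c) *\<^sub>R c) \<bullet> e = ln (k c) * (a \<bullet> a)" using primitive_norm_const[OF a c] by simp
      qed
      moreover have "ln (prod k B) = (\<Sum>c\<in>B. ln (k c))"
        using k by (intro ln_prod) (use B in \<open>auto simp: complete_system_def\<close>)
      ultimately show ?thesis by (simp add: sum_distrib_left mult.commute)
    qed
    have "(a \<bullet> a) * ln (prod l C) = (a \<bullet> a) * ln (prod l' C')"
      by (simp only: trace[OF C l, symmetric] trace[OF C' l', symmetric] functional_calculus_unique[OF sys eq, of ln])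
    then have "ln (prod l C) = ln (prod l' C')" using primitiveD(2)[OF a] by simp
    moreover have "0 < prod l C" "0 < prod l' C'" using l l' by (auto intro: prod_pos)
    ultimately show ?thesis using d by simp
  next
    case False
    then have "C = {}" "C' = {}" using C C' by (auto simp: complete_system_iff)
    then show ?thesis using d by simp
  qed
qed

end

context eja begin

lemma inv_sqrt_eq:
  assumes C: "complete_system mul e C"
  shows "inv_sqrt mul e (\<Sum>c\<in>C. l c *\<^sub>R c) = (\<Sum>c\<in>C. (l c powr (-1/2)) *\<^sub>R c)"
  unfolding inv_sqrt_def spectral_decomposition_def
proof (rule the_equality)
  show "\<exists>C' l'. (complete_system mul e C' \<and> (\<Sum>c\<in>C. l c *\<^sub>R c) = (\<Sum>c\<in>C'. l' c *\<^sub>R c)) \<and>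
      (\<Sum>c\<in>C. (l c powr (-1/2)) *\<^sub>R c) = (\<Sum>c\<in>C'. (l' c powr (-1/2)) *\<^sub>R c)"
    using C by blast
next
  fix y assume "\<exists>C' l'. (complete_system mul e C' \<and> (\<Sum>c\<in>C. l c *\<^sub>R c) = (\<Sum>c\<in>C'. l' c *\<^sub>R c)) \<and>
      y = (\<Sum>c\<in>C'. (l' c powr (-1/2)) *\<^sub>R c)"
  then obtain C' l' where C': "complete_system mul e C'" "(\<Sum>c\<in>C. l c *\<^sub>R c) = (\<Sum>c\<in>C'. l' c *\<^sub>R c)"
    and y: "y = (\<Sum>c\<in>C'. (l' c powr (-1/2)) *\<^sub>R c)" by blast
  have "idem_system C" "idem_system C'" using C C'(1) by (simp_all add: complete_system_iff)
  from functional_calculus_unique[OF this C'(2), of "\<lambda>s. s powr (-1/2)"]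
  show "y = (\<Sum>c\<in>C. (l c powr (-1/2)) *\<^sub>R c)" by (simp add: y)
qed

lemma spectral_pos:
  assumes "pos x"
  obtains C l where "complete_system mul e C" "x = (\<Sum>c\<in>C. l c *\<^sub>R c)" "\<forall>c\<in>C. 0 < l c"
proof -
  obtain C l where C: "complete_system mul e C" "x = (\<Sum>c\<in>C. l c *\<^sub>R c)" using spectral .
  then show ?thesis using that assms pos_spectral_iff[of C l] by (simp add: complete_system_iff)
qed

lemma inv_sqrt_pos: "pos w \<Longrightarrow> pos (inv_sqrt mul e w)"
proof -
  assume "pos w"
  then obtain C l where C: "complete_system mul e C" "w = (\<Sum>c\<in>C. l c *\<^sub>R c)" "\<forall>c\<in>C. 0 < l c"
    using spectral_pos by blast
  then show ?thesis using pos_spectral_iff[of C "\<lambda>c. l c powr (-1/2)"]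
    by (auto simp: inv_sqrt_eq complete_system_iff)
qed

lemma inv_sqrt_scale:
  assumes "pos w" "0 < s"
  shows "inv_sqrt mul e (s *\<^sub>R w) = (s powr (-1/2)) *\<^sub>R inv_sqrt mul e w"
proof -
  obtain C l where C: "complete_system mul e C" "w = (\<Sum>c\<in>C. l c *\<^sub>R c)" "\<forall>c\<in>C. 0 < l c"
    using spectral_pos[OF assms(1)] .
  have "inv_sqrt mul e (s *\<^sub>R w) = (\<Sum>c\<in>C. ((s * l c) powr (-1/2)) *\<^sub>R c)"
    using inv_sqrt_eq[OF C(1), of "\<lambda>c. s * l c"] by (simp add: C(2) scaleR_sum_right)
  also have "\<dots> = (\<Sum>c\<in>C. (s powr (-1/2) * l c powr (-1/2)) *\<^sub>R c)"
    using C(3) assms(2) by (intro sum.cong) (auto simp: powr_mult)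
  finally show ?thesis unfolding C(2) inv_sqrt_eq[OF C(1)] by (simp add: scaleR_sum_right)
qed

lemma P_spectral:
  assumes C: "idem_system C"
  shows "P (\<Sum>c\<in>C. l c *\<^sub>R c) (\<Sum>c\<in>C. k c *\<^sub>R c) = (\<Sum>c\<in>C. ((l c)\<^sup>2 * k c) *\<^sub>R c)"
  unfolding P_eq idem_system_mul[OF C] scaleR_sum_right sum_subtractf[symmetric]
  by (intro sum.cong) (simp_all add: algebra_simps power2_eq_square flip: scaleR_diff_left)

lemma inv_sqrt_e: "inv_sqrt mul e e = e"
proof -
  obtain C l where "complete_system mul e C" "e = (\<Sum>c\<in>C. l c *\<^sub>R c)" using spectral .
  then show ?thesis using inv_sqrt_eq[of C "\<lambda>_. 1"] by (simp add: complete_system_def)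
qed

lemma P_e [simp]: "P e x = x"
  by (simp add: P_eq scaleR_2)

lemma inv_sqrt_surj:
  assumes "pos y"
  obtains w where "pos w" "inv_sqrt mul e w = y"
proof -
  obtain C l where C: "complete_system mul e C" and y: "y = (\<Sum>c\<in>C. l c *\<^sub>R c)" and l: "\<forall>c\<in>C. 0 < l c"
    using spectral_pos[OF assms] .
  have sys: "idem_system C" using C by (simp add: complete_system_iff)
  let ?w = "\<Sum>c\<in>C. (l c powr (-2)) *\<^sub>R c"
  show ?thesis
  proof
    show "pos ?w" using l by (auto simp: pos_spectral_iff[OF sys])
    have "inv_sqrt mul e ?w = (\<Sum>c\<in>C. ((l c powr (-2)) powr (-1/2)) *\<^sub>R c)" by (rule inv_sqrt_eq[OF C])
    also have "\<dots> = y" unfolding y using l by (intro sum.cong) (auto simp: powr_powr)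
    finally show "inv_sqrt mul e ?w = y" .
  qed
qed

lemma P_inv_sqrt_scale:
  assumes "pos w" "0 < s"
  shows "P (inv_sqrt mul e (s *\<^sub>R w)) (s *\<^sub>R x) = P (inv_sqrt mul e w) x"
proof -
  have "(s powr (-1/2))\<^sup>2 * s = s powr (-1/2) * s powr (-1/2) * s powr 1"
    using assms(2) by (simp add: power2_eq_square)
  also have "\<dots> = s powr (-1/2 + -1/2 + 1)" by (simp only: powr_add)
  finally have "(s powr (-1/2))\<^sup>2 * s = 1" using assms(2) by simp
  then show ?thesis by (simp add: inv_sqrt_scale[OF assms] P_scale linear_scale[OF linear_P] mult.commute[of s])
qed

end

section \<open>The functional equation\<close>

lemma additive_continuous_real:
  fixes h :: "real \<Rightarrow> real"
  assumes add: "\<And>s t. h (s + t) = h s + h t" and cont: "continuous_on UNIV h"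
  shows "h t = t * h 1"
proof -
  have 0: "h 0 = 0" using add[of 0 0] by simp
  have minus: "h (- t) = - h t" for t using add[of t "- t"] 0 by simp
  have nat: "h (real n * t) = real n * h t" for n t
    by (induction n) (simp_all add: 0 add algebra_simps)
  have int: "h (of_int k * t) = of_int k * h t" for k t
    by (cases k rule: int_cases2) (simp_all add: nat minus)
  have "h q = q * h 1" if q: "q \<in> \<rat>" for q
  proof -
    obtain m n where mn: "n \<noteq> 0" "q = of_int m / real n" using q by (auto simp: Rats_eq_int_div_nat)
    have "real n * h q = h (real n * q)" by (simp add: nat)
    also have "real n * q = of_int m * 1" using mn by simp
    also have "h \<dots> = of_int m * h 1" by (rule int)
    finally have "h q = of_int m / real n * h 1" using mn(1) by (simp add: field_simps)
    then show ?thesis using mn(2) by simp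
  qed
  moreover have "closed {t. h t = t * h 1}"
    by (intro closed_Collect_eq continuous_intros cont)
  ultimately have "closure \<rat> \<subseteq> {t. h t = t * h 1}" by (intro closure_minimal subsetI) blast+
  then have "t \<in> {t. h t = t * h 1}" using Rats_closure_real by blast
  then show ?thesis by blast
qed

lemma multiplicative_to_additive_ln:
  fixes \<phi> :: "real \<Rightarrow> real"
  assumes mult: "\<And>s t. 0 < s \<Longrightarrow> 0 < t \<Longrightarrow> \<phi> (s * t) = \<phi> s + \<phi> t" and cont: "continuous_on {0<..} \<phi>"
    and s: "0 < s"
  shows "\<phi> s = \<phi> (exp 1) * ln s"
proof -
  have "continuous_on UNIV (\<lambda>u. \<phi> (exp u))"
    by (rule continuous_on_compose2[OF cont]) (auto intro: continuous_intros)
  then have "\<phi> (exp (ln s)) = ln s * \<phi> (exp 1)"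
    by (intro additive_continuous_real[of "\<lambda>u. \<phi> (exp u)"]) (simp_all add: exp_add mult)
  then show ?thesis using s by simp
qed

section \<open>Additive functions and the Pexider equation on the cone\<close>

context eja begin

lemma pos_shift:
  obtains s where "0 < s" "pos (v + s *\<^sub>R e)"
proof -
  have "((\<lambda>t. e + t *\<^sub>R v) \<longlongrightarrow> e + 0 *\<^sub>R v) (at_right 0)" by (intro tendsto_intros)
  then have "\<forall>\<^sub>F t in at_right 0. e + t *\<^sub>R v \<in> {x. pos x}"
    by (rule topological_tendstoD) (simp_all add: open_pos pos_e)
  then have "\<forall>\<^sub>F t in at_right (0::real). 0 < t \<and> pos (e + t *\<^sub>R v)"
    using eventually_at_right_less[of "0::real"] by eventually_elim simp
  then have "\<exists>t>0. pos (e + t *\<^sub>R v)"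
    by (rule eventually_happens'[OF trivial_limit_at_right_real])
  then obtain t where t: "0 < t" "pos (e + t *\<^sub>R v)" by blast
  have "pos ((1 / t) *\<^sub>R (e + t *\<^sub>R v))" using t by (intro pos_scale) auto
  then show ?thesis using that[of "1 / t"] t by (simp add: scaleR_add_right add.commute)
qed

lemma pos_scaled_e: "0 < s \<Longrightarrow> pos (s *\<^sub>R e)"
  by (simp add: pos_scale pos_e)

text \<open>Every vector is a difference of cone elements \<open>v + s e\<close> and
  \<open>s e\<close>, so \<open>g\<close> extends to an additive \<open>G\<close> on the whole
  space. Continuity makes \<open>G\<close> linear, and \<open>adjoint G 1\<close> is the vector
  representing it.\<close>

lemma additive_on_cone:
  fixes g :: "'a \<Rightarrow> real"
  assumes add: "\<And>x y. pos x \<Longrightarrow> pos y \<Longrightarrow> g (x + y) = g x + g y"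
    and cont: "continuous_on {x. pos x} g"
  obtains \<Lambda> where "\<And>x. pos x \<Longrightarrow> g x = \<Lambda> \<bullet> x"
proof -
  define G where "G v = (let s = SOME s. 0 < s \<and> pos (v + s *\<^sub>R e) in g (v + s *\<^sub>R e) - g (s *\<^sub>R e))" for v
  have G: "G v = g (v + s *\<^sub>R e) - g (s *\<^sub>R e)" if s: "0 < s" "pos (v + s *\<^sub>R e)" for v s
  proof -
    define r where "r = (SOME s. 0 < s \<and> pos (v + s *\<^sub>R e))"
    have r: "0 < r \<and> pos (v + r *\<^sub>R e)" unfolding r_def by (rule someI[of _ s]) (use s in simp)
    have "g (v + r *\<^sub>R e) + g (s *\<^sub>R e) = g ((v + r *\<^sub>R e) + s *\<^sub>R e)"
      using r s by (intro add[symmetric] pos_scaled_e) auto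
    also have "(v + r *\<^sub>R e) + s *\<^sub>R e = (v + s *\<^sub>R e) + r *\<^sub>R e" by (simp add: ac_simps)
    also have "g \<dots> = g (v + s *\<^sub>R e) + g (r *\<^sub>R e)"
      using r s by (intro add pos_scaled_e) auto
    finally show ?thesis by (simp add: G_def Let_def flip: r_def)
  qed
  have G_pos: "G x = g x" if "pos x" for x
  proof -
    have "pos (x + 1 *\<^sub>R e)" using that by (simp add: pos_add pos_e)
    from G[OF _ this] show ?thesis using that add[OF that pos_e] by simp
  qed
  have G_add: "G (v + w) = G v + G w" for v w
  proof -
    obtain s where s: "0 < s" "pos (v + s *\<^sub>R e)" by (rule pos_shift)
    obtain r where r: "0 < r" "pos (w + r *\<^sub>R e)" by (rule pos_shift)
    have sum: "v + w + (s + r) *\<^sub>R e = (v + s *\<^sub>R e) + (w + r *\<^sub>R e)" by (simp add: algebra_simps)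
    have "pos (v + w + (s + r) *\<^sub>R e)" unfolding sum by (rule pos_add[OF s(2) r(2)])
    then have "G (v + w) = g (v + w + (s + r) *\<^sub>R e) - g ((s + r) *\<^sub>R e)"
      using s r by (intro G) auto
    also have "\<dots> = g ((v + s *\<^sub>R e) + (w + r *\<^sub>R e)) - g (s *\<^sub>R e + r *\<^sub>R e)"
      unfolding sum by (simp only: scaleR_add_left)
    finally show ?thesis using s r by (simp add: add pos_scaled_e G)
  qed
  have G_scale: "G (t *\<^sub>R v) = t * G v" for t v
  proof -
    have "isCont (\<lambda>t. G (t *\<^sub>R v)) t0" for t0
    proof -
      \<comment> \<open>A shift that works at \<open>t0\<close> works for all nearby
        \<open>t\<close>, so \<open>G\<close> inherits the continuity of \<open>g\<close>
        there.\<close>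
      obtain s where s: "0 < s" "pos (t0 *\<^sub>R v + s *\<^sub>R e)" by (rule pos_shift)
      have lim: "((\<lambda>t. t *\<^sub>R v + s *\<^sub>R e) \<longlongrightarrow> t0 *\<^sub>R v + s *\<^sub>R e) (nhds t0)"
        by (intro tendsto_intros) (simp add: filterlim_ident)
      have "\<forall>\<^sub>F t in nhds t0. t *\<^sub>R v + s *\<^sub>R e \<in> {x. pos x}"
        using lim by (rule topological_tendstoD) (simp_all add: open_pos s)
      then have ev: "\<forall>\<^sub>F t in nhds t0. G (t *\<^sub>R v) = g (t *\<^sub>R v + s *\<^sub>R e) - g (s *\<^sub>R e)"
        by eventually_elim (simp add: G s)
      have "isCont g (t0 *\<^sub>R v + s *\<^sub>R e)"
        using continuous_on_eq_continuous_at[OF open_pos] cont s by blast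
      moreover have "isCont (\<lambda>t. t *\<^sub>R v + s *\<^sub>R e) t0" by (intro continuous_intros)
      ultimately have "isCont (\<lambda>t. g (t *\<^sub>R v + s *\<^sub>R e)) t0" by (rule isCont_o2[rotated])
      then have "isCont (\<lambda>t. g (t *\<^sub>R v + s *\<^sub>R e) - g (s *\<^sub>R e)) t0" by (intro continuous_intros)
      then show ?thesis using isCont_cong[OF ev] by simp
    qed
    then have "continuous_on UNIV (\<lambda>t. G (t *\<^sub>R v))" by (simp add: continuous_on_eq_continuous_at)
    then show ?thesis
      using additive_continuous_real[of "\<lambda>t. G (t *\<^sub>R v)" t] by (simp add: G_add scaleR_add_left)
  qed
  have lin: "linear G" by (rule linearI) (simp_all add: G_add G_scale)
  have "g x = adjoint G 1 \<bullet> x" if "pos x" for x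
    using adjoint_works[OF lin, of x 1] G_pos[OF that] by (simp add: inner_commute)
  then show ?thesis by (rule that)
qed

text \<open>The increment over \<open>z\<close> is the same for \<open>a\<close> at any
  \<open>x\<close> and \<open>b\<close> at any \<open>y\<close>, so it depends on \<open>z\<close>
  alone; consecutive increments add up, which makes it additive. Passing from \<open>e\<close> to
  \<open>x + e\<close> and from \<open>x\<close> to \<open>x + e\<close> then yields the affine
  form.\<close>

lemma pexider_on_cone:
  fixes a b c :: "'a \<Rightarrow> real"
  assumes eq: "\<And>x y. pos x \<Longrightarrow> pos y \<Longrightarrow> a x + b y = c (x + y)"
    and cont: "continuous_on {x. pos x} a"
  shows "\<exists>\<Lambda> \<alpha> \<beta>. \<forall>x. pos x \<longrightarrow> a x = \<Lambda> \<bullet> x + \<alpha> \<and> b x = \<Lambda> \<bullet> x + \<beta>"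
proof -
  define g where "g z = a (e + z) - a e" for z
  have eq': "a (x + z) - a x = b (y + z) - b y" if "pos x" "pos y" "pos z" for x y z
    using eq[of "x + z" y] eq[of x "y + z"] that by (simp add: pos_add ac_simps)
  have ga: "a (x + z) - a x = g z" if "pos x" "pos z" for x z
    using eq'[OF that(1) pos_e that(2)] eq'[OF pos_e pos_e that(2)] by (simp add: g_def)
  have gb: "b (x + z) - b x = g z" if "pos x" "pos z" for x z
    using eq'[OF pos_e that] by (simp add: g_def)
  have "g (x + y) = g x + g y" if "pos x" "pos y" for x y
    using ga[of "e + x" y] ga[of e x] that by (simp add: g_def pos_add pos_e ac_simps)
  moreover have "continuous_on {x. pos x} g"
    unfolding g_def
    by (intro continuous_intros continuous_on_compose2[OF cont]) (auto intro: continuous_intros pos_add pos_e)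
  ultimately obtain \<Lambda> where \<Lambda>: "\<And>x. pos x \<Longrightarrow> g x = \<Lambda> \<bullet> x" using additive_on_cone by blast
  have "a x = \<Lambda> \<bullet> x + (a e - \<Lambda> \<bullet> e)" if "pos x" for x
    using ga[OF that pos_e] ga[OF pos_e that] \<Lambda>[OF that] \<Lambda>[OF pos_e] by (simp add: ac_simps)
  moreover have "b x = \<Lambda> \<bullet> x + (b e - \<Lambda> \<bullet> e)" if "pos x" for x
    using gb[OF that pos_e] gb[OF pos_e that] \<Lambda>[OF that] \<Lambda>[OF pos_e] by (simp add: ac_simps)
  ultimately show ?thesis by blast
qed

text \<open>The argument of \<open>d\<close> does not change under a common scaling of \<open>x\<close> and \<open>y\<close>, so
  \<open>d\<close> cancels and a Pexider equation remains.\<close>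

lemma scaling_behaviour:
  fixes a b c d :: "'a \<Rightarrow> real"
  assumes eqn: "\<And>x y. pos x \<Longrightarrow> pos y \<Longrightarrow> a x + b y = c (x + y) + d (P (inv_sqrt mul e (x + y)) x)"
    and cont: "continuous_on {x. pos x} a"
  obtains \<Lambda> \<alpha> \<beta> where
    "\<And>s x. 0 < s \<Longrightarrow> pos x \<Longrightarrow> a (s *\<^sub>R x) = a x + (s - 1) * (\<Lambda> \<bullet> x) + \<alpha> s"
    "\<And>s x. 0 < s \<Longrightarrow> pos x \<Longrightarrow> b (s *\<^sub>R x) = b x + (s - 1) * (\<Lambda> \<bullet> x) + \<beta> s"
proof -
  have "\<exists>\<Lambda> \<alpha> \<beta>. \<forall>x. pos x \<longrightarrow> a (s *\<^sub>R x) - a x = \<Lambda> \<bullet> x + \<alpha> \<and> b (s *\<^sub>R x) - b x = \<Lambda> \<bullet> x + \<beta>"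
    if s: "0 < s" for s
  proof -
    have eq: "(a (s *\<^sub>R x) - a x) + (b (s *\<^sub>R y) - b y) = c (s *\<^sub>R (x + y)) - c (x + y)"
      if "pos x" "pos y" for x y
      using eqn[of "s *\<^sub>R x" "s *\<^sub>R y"] eqn[of x y] P_inv_sqrt_scale[of "x + y" s x] that s
      by (simp add: pos_scale pos_add flip: scaleR_add_right)
    have "continuous_on {x. pos x} (\<lambda>x. a (s *\<^sub>R x) - a x)"
      using s by (intro continuous_intros cont continuous_on_compose2[OF cont]) (auto intro: continuous_intros pos_scale)
    from pexider_on_cone[OF eq this] show ?thesis .
  qed
  then obtain L \<alpha> \<beta> where L: "\<And>s x. 0 < s \<Longrightarrow> pos x \<Longrightarrow> a (s *\<^sub>R x) - a x = L s \<bullet> x + \<alpha> s"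
    "\<And>s x. 0 < s \<Longrightarrow> pos x \<Longrightarrow> b (s *\<^sub>R x) - b x = L s \<bullet> x + \<beta> s"
    by metis
  \<comment> \<open>\<open>a (2 s x)\<close> is computed by scaling with 2 and \<open>s\<close> in
    either order; the additive constants cancel, and \<open>L 2\<close> becomes the required
    \<Lambda>.\<close>
  have "L s \<bullet> x = (s - 1) * (L 2 \<bullet> x)" if "0 < s" "pos x" for s x
    using L(1)[of s "2 *\<^sub>R x"] L(1)[of 2 "s *\<^sub>R x"] L(1)[of 2 x] L(1)[of s x] that
    by (simp add: pos_scale algebra_simps)
  then show ?thesis using L by (intro that[of "L 2" \<alpha> \<beta>]) (force simp: algebra_simps)+
qed

section \<open>Elimination of \<open>d\<close> by a limit at the origin\<close>

lemma P_inv_sqrt_self: "pos w \<Longrightarrow> P (inv_sqrt mul e w) w = e"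
proof -
  assume "pos w"
  then obtain C l where C: "complete_system mul e C" "w = (\<Sum>c\<in>C. l c *\<^sub>R c)" "\<forall>c\<in>C. 0 < l c"
    using spectral_pos by blast
  have "P (inv_sqrt mul e w) w = (\<Sum>c\<in>C. ((l c powr (-1/2))\<^sup>2 * l c) *\<^sub>R c)"
    unfolding C(2) inv_sqrt_eq[OF C(1)] using C(1) by (intro P_spectral) (simp add: complete_system_iff)
  also have "\<dots> = (\<Sum>c\<in>C. c)"
  proof (rule sum.cong[OF refl])
    fix c assume "c \<in> C"
    then have "0 < l c" using C(3) by blast
    then have "(l c powr (-1/2))\<^sup>2 * l c = l c powr (-1/2) * l c powr (-1/2) * l c powr 1"
      by (simp add: power2_eq_square)
    also have "\<dots> = l c powr (-1/2 + -1/2 + 1)" by (simp only: powr_add)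
    finally show "((l c powr (-1/2))\<^sup>2 * l c) *\<^sub>R c = c" using \<open>0 < l c\<close> by simp
  qed
  finally show ?thesis using C(1) by (simp add: complete_system_def)
qed

text \<open>The pairs \<open>(t x, w - t x)\<close> and \<open>(t v, e - t v)\<close> with
  \<open>v = P (w^(-1/2)) x\<close> have the same quotient \<open>t v\<close>; let \<open>t\<close> tend to \<open>0\<close>.\<close>

lemma quotient_cancel:
  fixes a b c d :: "'a \<Rightarrow> real"
  assumes eqn: "\<And>x y. pos x \<Longrightarrow> pos y \<Longrightarrow> a x + b y = c (x + y) + d (P (inv_sqrt mul e (x + y)) x)"
    and cont: "continuous_on {x. pos x} b"
    and scale: "\<And>s x. 0 < s \<Longrightarrow> pos x \<Longrightarrow> a (s *\<^sub>R x) = a x + \<alpha> s"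
    and w: "pos w" and x: "pos x"
  shows "a (P (inv_sqrt mul e w) x) + b e - c e = a x + b w - c w"
proof -
  define v where "v = P (inv_sqrt mul e w) x"
  have v: "pos v" unfolding v_def using inv_sqrt_pos[OF w] x by (rule P_pos)
  have lim: "((\<lambda>t. u - t *\<^sub>R z) \<longlongrightarrow> u) (at_right 0)" for u z :: 'a
  proof -
    have "((\<lambda>t. u - t *\<^sub>R z) \<longlongrightarrow> u - 0 *\<^sub>R z) (at_right 0)" by (intro tendsto_intros)
    then show ?thesis by simp
  qed
  have ev: "\<forall>\<^sub>F t in at_right 0. pos (u - t *\<^sub>R z)" if "pos u" for u z
    using topological_tendstoD[OF lim open_pos] that by simp
  \<comment> \<open>Both \<open>a (t x)\<close> and \<open>a (t v)\<close> contribute the same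
    \<open>\<alpha> t\<close>, so subtracting the equations of the two pairs removes it together
    with \<open>d (t v)\<close>, and the right-hand side is constant in \<open>t\<close>.\<close>
  have ev_const: "\<forall>\<^sub>F t in at_right 0. b (w - t *\<^sub>R x) - b (e - t *\<^sub>R v) = a v - c e - a x + c w"
    using ev[OF w, of x] ev[OF pos_e, of v] eventually_at_right_less[of "0::real"]
  proof eventually_elim
    case (elim t)
    have "a (t *\<^sub>R x) + b (w - t *\<^sub>R x) = c w + d (t *\<^sub>R v)"
      using eqn[of "t *\<^sub>R x" "w - t *\<^sub>R x"] elim x by (simp add: pos_scale v_def linear_scale[OF linear_P])
    moreover have "a (t *\<^sub>R v) + b (e - t *\<^sub>R v) = c e + d (t *\<^sub>R v)"
      using eqn[of "t *\<^sub>R v" "e - t *\<^sub>R v"] elim v by (simp add: pos_scale inv_sqrt_e)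
    ultimately show ?case using scale[of t x] scale[of t v] elim x v by simp
  qed
  have "((\<lambda>t. b (u - t *\<^sub>R z)) \<longlongrightarrow> b u) (at_right 0)" if "pos u" for u z
    using continuous_on_eq_continuous_at[OF open_pos] cont that lim[of u z]
    by (intro isCont_tendsto_compose[of u b]) blast+
  then have "((\<lambda>t. b (w - t *\<^sub>R x) - b (e - t *\<^sub>R v)) \<longlongrightarrow> b w - b e) (at_right 0)"
    using w pos_e by (intro tendsto_diff) auto
  then have "((\<lambda>t. a v - c e - a x + c w) \<longlongrightarrow> b w - b e) (at_right (0::real))"
    by (rule iffD1[OF tendsto_cong[OF ev_const]])
  then have "a v - c e - a x + c w = b w - b e"
    by (intro tendsto_unique[OF _ tendsto_const]) auto
  then show ?thesis by (simp add: v_def)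
qed

text \<open>With \<open>x = w\<close> the quotient is \<open>e\<close>, which gives the formula for
  \<open>c\<close>. For the product rule choose \<open>w\<close> with \<open>w^(-1/2) = y\<close>;
  the instances at \<open>x\<close> and at \<open>e\<close> then eliminate
  \<open>a w\<close>.\<close>

lemma multiplicative_part:
  fixes a b c d :: "'a \<Rightarrow> real"
  assumes eqn: "\<And>x y. pos x \<Longrightarrow> pos y \<Longrightarrow> a x + b y = c (x + y) + d (P (inv_sqrt mul e (x + y)) x)"
    and cont: "continuous_on {x. pos x} b"
    and scale: "\<And>s x. 0 < s \<Longrightarrow> pos x \<Longrightarrow> a (s *\<^sub>R x) = a x + \<alpha> s"
  shows "pos w \<Longrightarrow> c w = a w + b w + (c e - a e - b e)"
    and "pos y \<Longrightarrow> pos x \<Longrightarrow> a (P y x) - a e = (a x - a e) + (a (y \<odot> y) - a e)"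
proof -
  have Q: "a (P (inv_sqrt mul e w) x) + b e - c e = a x + b w - c w" if "pos w" "pos x" for w x
    using quotient_cancel[of a b c d \<alpha> w x] eqn cont scale that by blast
  show c: "c w = a w + b w + (c e - a e - b e)" if w: "pos w" for w
    using Q[OF w w] P_inv_sqrt_self[OF w] by simp
  show "a (P y x) - a e = (a x - a e) + (a (y \<odot> y) - a e)" if y: "pos y" and x: "pos x"
  proof -
    obtain w where w: "pos w" "inv_sqrt mul e w = y" using inv_sqrt_surj[OF y] by metis
    have *: "a (P y z) - a e = a z - a w" if "pos z" for z
      using Q[OF w(1) that] c[OF w(1)] by (simp add: w(2))
    have "P y e = y \<odot> y" by (simp add: P_eq scaleR_2)
    then show ?thesis using *[OF x] *[OF pos_e] by simp
  qed
qed

end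

section \<open>Multiplicative functions\<close>

context eja begin

lemma pos_unit_idem:
  assumes c: "c \<odot> c = c" and s: "0 < s"
  shows "pos (e + (s - 1) *\<^sub>R c)"
proof (cases "1 \<le> s")
  case True
  then show ?thesis by (intro pos_add_nonneg pos_e nonneg_scale nonneg_idem c) simp
next
  case False
  have "(e - c) \<odot> (e - c) = e - c" by (simp add: mul_simps c)
  then have "pos (s *\<^sub>R e + (1 - s) *\<^sub>R (e - c))"
    using s False by (intro pos_add_nonneg pos_scaled_e nonneg_scale nonneg_idem) simp_all
  then show ?thesis by (simp add: algebra_simps)
qed

lemma P_unit_idem:
  assumes c: "c \<odot> c = c" and cz: "c \<odot> z = 0"
  shows "P (e + (m - 1) *\<^sub>R c) (e + ((t - 1) *\<^sub>R c + z)) = e + ((m\<^sup>2 * t - 1) *\<^sub>R c + z)"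
proof (rule vector_eq_rdot[THEN iffD1, rule_format])
  fix u
  have zc: "z \<odot> c = 0" using cz by (simp add: comm)
  show "P (e + (m - 1) *\<^sub>R c) (e + ((t - 1) *\<^sub>R c + z)) \<bullet> u = (e + ((m\<^sup>2 * t - 1) *\<^sub>R c + z)) \<bullet> u"
    by (simp add: P_eq mul_simps c cz zc inner_add_left inner_diff_left power2_eq_square algebra_simps)
qed

text \<open>In the 2 by 2 picture \<open>a = diag(1,0)\<close>, \<open>b\<close> projects onto a
  unit vector with squared first coordinate \<open>t\<close>, \<open>c = diag(0,1)\<close> and
  \<open>v\<close> is the off-diagonal unit. The last clause expresses the block identity
  \<open>a + c\<close> symmetrically in \<open>a\<close> and \<open>b\<close>, as their norms
  agree.\<close>

lemma primitive_complement:
  assumes a: "primitive_idempotent mul a" and b: "primitive_idempotent mul b"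
    and nz: "a \<bullet> b \<noteq> 0" and neq: "a \<noteq> b"
  obtains c v where "c \<odot> c = c" "a \<odot> c = 0" "v \<odot> v = a + c" "a \<odot> v = (1/2) *\<^sub>R v" "c \<odot> v = (1/2) *\<^sub>R v"
    "a + c = (1 / (1 - (a \<bullet> b) / (a \<bullet> a))) *\<^sub>R (a + b - 2 *\<^sub>R (a \<odot> b))"
proof -
  note D = primitiveD[OF a] primitiveD[OF b]
  have norm: "a \<bullet> a = b \<bullet> b" by (rule primitive_norm_eq[OF a b nz])
  define w t where "w = a \<odot> b" and "t = (a \<bullet> b) / (a \<bullet> a)"
  have aw: "a \<odot> w = (1/2) *\<^sub>R (w + t *\<^sub>R a)" unfolding w_def t_def by (rule primitive_mul_mul[OF a])
  have bw: "b \<odot> w = (1/2) *\<^sub>R (w + t *\<^sub>R b)"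
    unfolding w_def t_def using primitive_mul_mul[OF b, of a] by (simp add: comm[of b a] inner_commute norm)
  have ww: "w \<odot> w = (t/4) *\<^sub>R (a + b + 2 *\<^sub>R w)"
    unfolding w_def t_def by (rule primitive_square[OF a b norm])
  have ab: "a \<odot> b = w" "b \<odot> a = w" by (simp_all add: w_def comm)
  have wa: "w \<odot> a = (1/2) *\<^sub>R (w + t *\<^sub>R a)" and wb: "w \<odot> b = (1/2) *\<^sub>R (w + t *\<^sub>R b)"
    using aw bw by (simp_all add: comm)
  have "a \<bullet> b = (a \<odot> b) \<bullet> b" using inner_assoc[of a b b] D by simp
  then have "a \<bullet> b > 0" using idem_psd[OF D(1), of b] nz by simp
  then have t0: "t > 0" using D by (simp add: t_def)
  have "0 < (a - b) \<bullet> (a - b)" using neq by simp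
  then have "a \<bullet> b < a \<bullet> a" using norm by (simp add: inner_diff_left inner_diff_right inner_commute)
  then have t1: "t < 1" using D by (simp add: t_def)
  \<comment> \<open>In that picture \<open>x\<close> is (1 - t) diag(0,1) and \<open>y\<close> has
    off-diagonal entry sqrt(t (1 - t)) / 2, whence the normalisations of \<open>c\<close> and
    \<open>v\<close> below.\<close>
  define x y where "x = b - 2 *\<^sub>R w + t *\<^sub>R a" and "y = w - t *\<^sub>R a"
  have xx: "x \<odot> x = (1 - t) *\<^sub>R x"
  proof (rule vector_eq_rdot[THEN iffD1, rule_format])
    fix u show "(x \<odot> x) \<bullet> u = ((1 - t) *\<^sub>R x) \<bullet> u"
      by (simp add: x_def mul_simps D ab aw wa bw wb ww inner_add_left inner_diff_left) (simp add: field_simps)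
  qed
  have ax: "a \<odot> x = 0" by (simp add: x_def mul_simps D ab aw)
  have yy: "4 *\<^sub>R (y \<odot> y) = (t * (1 - t)) *\<^sub>R a + t *\<^sub>R x"
  proof (rule vector_eq_rdot[THEN iffD1, rule_format])
    fix u show "(4 *\<^sub>R (y \<odot> y)) \<bullet> u = ((t * (1 - t)) *\<^sub>R a + t *\<^sub>R x) \<bullet> u"
      by (simp add: x_def y_def mul_simps D ab aw wa ww inner_add_left inner_diff_left) (simp add: field_simps)
  qed
  have ay: "a \<odot> y = (1/2) *\<^sub>R y"
  proof (rule vector_eq_rdot[THEN iffD1, rule_format])
    fix u show "(a \<odot> y) \<bullet> u = ((1/2) *\<^sub>R y) \<bullet> u"
      by (simp add: y_def mul_simps D aw inner_add_left inner_diff_left, (simp add: field_simps)?)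
  qed
  have xy: "x \<odot> y = ((1 - t)/2) *\<^sub>R y"
  proof (rule vector_eq_rdot[THEN iffD1, rule_format])
    fix u show "(x \<odot> y) \<bullet> u = (((1 - t)/2) *\<^sub>R y) \<bullet> u"
      by (simp add: x_def y_def mul_simps D ab aw wa bw wb ww inner_add_left inner_diff_left) (simp add: field_simps)
  qed
  define c where "c = (1 / (1 - t)) *\<^sub>R x"
  define v where "v = (2 / sqrt (t * (1 - t))) *\<^sub>R y"
  have tt: "t * (1 - t) > 0" using t0 t1 by simp
  show ?thesis
  proof
    show "c \<odot> c = c" using t1 by (simp add: c_def mul_simps xx)
    show "a \<odot> c = 0" by (simp add: c_def mul_simps ax)
    have "(2 / sqrt (t * (1 - t)))\<^sup>2 = 4 / (t * (1 - t))"
      unfolding power_divide real_sqrt_pow2[OF less_imp_le[OF tt]] by simp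
    then have "v \<odot> v = (1 / (t * (1 - t))) *\<^sub>R (4 *\<^sub>R (y \<odot> y))"
      by (simp add: v_def mul_simps flip: power2_eq_square)
    also have "\<dots> = a + c" unfolding yy using t0 t1 by (simp add: c_def scaleR_add_right)
    finally show "v \<odot> v = a + c" .
    show "a \<odot> v = (1/2) *\<^sub>R v" by (simp add: v_def mul_simps ay)
    show "c \<odot> v = (1/2) *\<^sub>R v" using t1 by (simp add: v_def c_def mul_simps xy)
    have "a = (1 / (1 - t)) *\<^sub>R ((1 - t) *\<^sub>R a)" using t1 by simp
    then have "a + c = (1 / (1 - t)) *\<^sub>R ((1 - t) *\<^sub>R a + x)" unfolding c_def by (metis scaleR_add_right)
    also have "(1 - t) *\<^sub>R a + x = a + b - 2 *\<^sub>R w" by (simp add: x_def algebra_simps)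
    finally show "a + c = (1 / (1 - (a \<bullet> b) / (a \<bullet> a))) *\<^sub>R (a + b - 2 *\<^sub>R (a \<odot> b))" by (simp add: t_def w_def)
  qed
qed

end

section \<open>Values of a multiplicative function on frames\<close>

locale multiplicative_function = eja +
  fixes f :: "'a \<Rightarrow> real"
  assumes mult: "\<And>x y. pos y \<Longrightarrow> pos x \<Longrightarrow> f (P y x) = f x + f (y \<odot> y)"
    and cont: "continuous_on {x. pos x} f"
begin

text \<open>The value where the eigenvalue on \<open>c\<close> is \<open>exp 1\<close> and all
  others are 1; as \<open>ln (exp 1) = 1\<close>, this is the coefficient of the logarithm in
  \<open>f_idem\<close>.\<close>

definition \<kappa> :: "'a \<Rightarrow> real" where "\<kappa> c = f (e + (exp 1 - 1) *\<^sub>R c)"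

lemma f_e: "f e = 0"
  using mult[OF pos_e pos_e] by simp

text \<open>For \<open>y = e + (sqrt s - 1) c\<close>, the square of \<open>y\<close> carries
  \<open>s\<close> on \<open>c\<close>, while \<open>P y\<close> multiplies the coefficient
  \<open>t\<close> on \<open>c\<close> by \<open>s\<close> and fixes \<open>z\<close>.\<close>

lemma f_unit_idem:
  assumes c: "c \<odot> c = c" and cz: "c \<odot> z = 0" and s: "0 < s"
    and x: "pos (e + ((t - 1) *\<^sub>R c + z))"
  shows "f (e + ((s * t - 1) *\<^sub>R c + z)) = f (e + ((t - 1) *\<^sub>R c + z)) + f (e + (s - 1) *\<^sub>R c)"
proof -
  let ?y = "e + (sqrt s - 1) *\<^sub>R c"
  have "?y \<odot> ?y = P ?y (e + ((1 - 1) *\<^sub>R c + 0))" by (simp add: P_eq scaleR_2)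
  also have "\<dots> = e + (s - 1) *\<^sub>R c" using P_unit_idem[OF c, of 0 "sqrt s" 1] s by simp
  finally have "f (P ?y (e + ((t - 1) *\<^sub>R c + z))) = f (e + ((t - 1) *\<^sub>R c + z)) + f (e + (s - 1) *\<^sub>R c)"
    using mult[OF pos_unit_idem[OF c, of "sqrt s"] x] s by simp
  then show ?thesis using P_unit_idem[OF c cz, of "sqrt s" t] s by simp
qed

lemma f_idem:
  assumes c: "c \<odot> c = c" and s: "0 < s"
  shows "f (e + (s - 1) *\<^sub>R c) = \<kappa> c * ln s"
  unfolding \<kappa>_def
proof (rule multiplicative_to_additive_ln[OF _ _ s])
  show "f (e + (s * t - 1) *\<^sub>R c) = f (e + (s - 1) *\<^sub>R c) + f (e + (t - 1) *\<^sub>R c)" if "0 < s" "0 < t" for s t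
    using f_unit_idem[OF c, of 0 s t] pos_unit_idem[OF c that(2)] that by simp
  show "continuous_on {0<..} (\<lambda>s. f (e + (s - 1) *\<^sub>R c))"
    using pos_unit_idem[OF c] by (intro continuous_on_compose2[OF cont] continuous_intros) auto
qed

lemma f_split:
  assumes c: "c \<odot> c = c" and cz: "c \<odot> z = 0" and s: "0 < s" and z: "pos (e + z)"
  shows "f (e + ((s - 1) *\<^sub>R c + z)) = \<kappa> c * ln s + f (e + z)"
  using f_unit_idem[OF c cz s, of 1] z f_idem[OF c s] by simp

lemma \<kappa>_add:
  assumes a: "a \<odot> a = a" and c: "c \<odot> c = c" and ac: "a \<odot> c = 0"
  shows "\<kappa> (a + c) = \<kappa> a + \<kappa> c"
  using f_split[OF a, of "(exp 1 - 1) *\<^sub>R c" "exp 1"] pos_unit_idem[OF c, of "exp 1"] f_idem[OF c, of "exp 1"] ac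
  by (simp add: \<kappa>_def[of "a + c"] mul_simps scaleR_add_right)

lemma f_spectral:
  assumes C: "idem_system C" and l: "\<forall>c\<in>C. 0 < l c"
  shows "f (\<Sum>c\<in>C. l c *\<^sub>R c) = (\<Sum>c\<in>C. \<kappa> c * ln (l c))"
proof -
  note D = idem_systemD[OF C]
  have *: "pos (e + (\<Sum>c\<in>F. (l c - 1) *\<^sub>R c)) \<and> f (e + (\<Sum>c\<in>F. (l c - 1) *\<^sub>R c)) = (\<Sum>c\<in>F. \<kappa> c * ln (l c))"
    if "F \<subseteq> C" for F
    using finite_subset[OF that D(1)] that
  proof (induction F rule: finite_induct)
    case empty then show ?case by (simp add: pos_e f_e)
  next
    case (insert c F)
    let ?z = "\<Sum>c\<in>F. (l c - 1) *\<^sub>R c"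
    have c: "c \<in> C" "c \<odot> c = c" "0 < l c" using insert D(4) l by auto
    have IH: "pos (e + ?z)" "f (e + ?z) = (\<Sum>c\<in>F. \<kappa> c * ln (l c))" using insert by auto
    have cz: "c \<odot> ?z = 0"
      unfolding mul.sum_right using insert D(5) by (intro sum.neutral) (auto simp: mul_simps)
    \<comment> \<open>The enlarged partial sum is an image of the previous one under
      \<open>P\<close>, so \<open>P_pos\<close> keeps the induction inside the cone.\<close>
    have "P (e + (sqrt (l c) - 1) *\<^sub>R c) (e + ?z) = e + ((l c - 1) *\<^sub>R c + ?z)"
      using P_unit_idem[OF c(2) cz, of "sqrt (l c)" 1] c(3) by simp
    moreover have "pos (P (e + (sqrt (l c) - 1) *\<^sub>R c) (e + ?z))"
      using c by (intro P_pos pos_unit_idem IH) auto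
    ultimately have "pos (e + ((l c - 1) *\<^sub>R c + ?z))" by simp
    then show ?case using f_split[OF c(2) cz c(3) IH(1)] IH(2) insert(1,2) by simp
  qed
  have "e + (\<Sum>c\<in>C. (l c - 1) *\<^sub>R c) = (\<Sum>c\<in>C. l c *\<^sub>R c)"
    using idem_system_sum_diff[OF C, of l 1] by (simp add: algebra_simps)
  then show ?thesis using *[OF order_refl] by simp
qed

text \<open>The elements \<open>a\<close>, \<open>c\<close>, \<open>v\<close> span a copy of the symmetric \<open>2 \<times> 2\<close> matrices, with
  \<open>a = diag(1,0)\<close>, \<open>c = diag(0,1)\<close> and \<open>v\<close> the off-diagonal unit.  The identity
  \<open>n diag(11/4,1) n = diag(4/3,1) m diag(4/3,1)\<close> with \<open>n = (2 1; 1 2)\<close>,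
  \<open>m = (27/4 45/8; 45/8 27/4)\<close> stays true when the two coordinates are exchanged, and the exchange
  fixes \<open>n\<close> and \<open>m\<close>.\<close>

lemma \<kappa>_swap_aux:
  assumes a: "a \<odot> a = a" and c: "c \<odot> c = c" and ac: "a \<odot> c = 0"
    and vv: "v \<odot> v = a + c" and av: "a \<odot> v = (1/2) *\<^sub>R v" and cv: "c \<odot> v = (1/2) *\<^sub>R v"
  defines "n \<equiv> e + (a + c + v)" and "m \<equiv> e + ((23/4) *\<^sub>R (a + c) + (45/8) *\<^sub>R v)"
  shows "\<kappa> a * (ln (11/4) - ln (16/9)) = f m - f (n \<odot> n)"
proof -
  have comms: "c \<odot> a = 0" "v \<odot> a = (1/2) *\<^sub>R v" "v \<odot> c = (1/2) *\<^sub>R v"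
    using ac av cv by (simp_all add: comm)
  note T = a c ac vv av cv comms
  \<comment> \<open>The projections onto the diagonal (1,1) and the antidiagonal (1,-1), the common
    eigenvectors of \<open>n\<close> and \<open>m\<close> in the block. There \<open>n\<close> has
    eigenvalues 3, 1 and \<open>m\<close> has 99/8, 9/8, so both are \<open>e\<close> plus
    nonnegative multiples of \<open>p\<close> and \<open>q\<close>.\<close>
  define p q where "p = (1/2) *\<^sub>R (a + c + v)" and "q = (1/2) *\<^sub>R (a + c - v)"
  have pp: "p \<odot> p = p" and qq: "q \<odot> q = q"
    by (rule vector_eq_rdot[THEN iffD1, rule_format],
        simp add: p_def q_def mul_simps T inner_add_left inner_diff_left, simp add: field_simps)+
  have "pos (e + 2 *\<^sub>R p)" by (intro pos_add_nonneg pos_e nonneg_scale nonneg_idem pp) simp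
  then have n: "pos n" by (simp add: p_def n_def)
  have "pos (e + (91/8) *\<^sub>R p + (1/8) *\<^sub>R q)"
    by (intro pos_add_nonneg pos_e nonneg_scale nonneg_idem pp qq) simp_all
  moreover have "e + (91/8) *\<^sub>R p + (1/8) *\<^sub>R q = m"
    by (rule vector_eq_rdot[THEN iffD1, rule_format])
      (simp add: p_def q_def m_def inner_add_left inner_diff_left field_simps)
  ultimately have m: "pos m" by simp
  define x y where "x = e + (11/4 - 1) *\<^sub>R a" and "y = e + (4/3 - 1) *\<^sub>R a"
  have x: "pos x" and y: "pos y" unfolding x_def y_def by (rule pos_unit_idem[OF a]; simp)+
  have "P n x = P y m"
    by (rule vector_eq_rdot[THEN iffD1, rule_format])
      (simp add: x_def y_def n_def m_def P_eq mul_simps T inner_add_left inner_diff_left, simp add: field_simps)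
  then have "f x + f (n \<odot> n) = f m + f (y \<odot> y)" using mult[OF n x] mult[OF y m] by simp
  moreover have "y \<odot> y = e + (16/9 - 1) *\<^sub>R a"
    by (rule vector_eq_rdot[THEN iffD1, rule_format])
      (simp add: y_def mul_simps T inner_add_left inner_diff_left field_simps)
  then have "f (y \<odot> y) = \<kappa> a * ln (16/9)" using f_idem[OF a, of "16/9"] by simp
  moreover have "f x = \<kappa> a * ln (11/4)" unfolding x_def by (rule f_idem[OF a]) simp
  ultimately show ?thesis by (simp add: algebra_simps)
qed

lemma \<kappa>_swap:
  assumes "a \<odot> a = a" "c \<odot> c = c" "a \<odot> c = 0"
    and "v \<odot> v = a + c" "a \<odot> v = (1/2) *\<^sub>R v" "c \<odot> v = (1/2) *\<^sub>R v"
  shows "\<kappa> a = \<kappa> c"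
proof -
  have "\<kappa> c * (ln (11/4) - ln (16/9)) = \<kappa> a * (ln (11/4) - ln (16/9))"
    using \<kappa>_swap_aux[OF assms] \<kappa>_swap_aux[of c a v] assms by (simp add: comm add.commute)
  moreover have "ln (11/4) \<noteq> ln (16/9 :: real)" by simp
  ultimately show ?thesis by simp
qed

text \<open>For distinct \<open>a\<close>, \<open>b\<close>, twice \<open>\<kappa> a\<close> is
  \<kappa> of the block identity \<open>a + c\<close>, by \<open>\<kappa>_add\<close> and
  \<open>\<kappa>_swap\<close>. That identity is symmetric in \<open>a\<close> and \<open>b\<close>,
  so it also gives twice \<open>\<kappa> b\<close>.\<close>

lemma \<kappa>_primitive:
  assumes a: "primitive_idempotent mul a" and b: "primitive_idempotent mul b" and nz: "a \<bullet> b \<noteq> 0"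
  shows "\<kappa> a = \<kappa> b"
proof (cases "a = b")
  case False
  have half: "2 * \<kappa> a = \<kappa> ((1 / (1 - (a \<bullet> b) / (a \<bullet> a))) *\<^sub>R (a + b - 2 *\<^sub>R (a \<odot> b)))"
    if ab: "primitive_idempotent mul a" "primitive_idempotent mul b" "a \<bullet> b \<noteq> 0" "a \<noteq> b" for a b
  proof -
    obtain c v where c: "c \<odot> c = c" "a \<odot> c = 0" "v \<odot> v = a + c" "a \<odot> v = (1/2) *\<^sub>R v" "c \<odot> v = (1/2) *\<^sub>R v"
      "a + c = (1 / (1 - (a \<bullet> b) / (a \<bullet> a))) *\<^sub>R (a + b - 2 *\<^sub>R (a \<odot> b))"
      using primitive_complement[OF ab] .
    note aa = primitiveD(1)[OF ab(1)]
    show ?thesis unfolding c(6)[symmetric] using \<kappa>_add[OF aa c(1,2)] \<kappa>_swap[OF aa c(1-5)] by simp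
  qed
  have "a \<bullet> a = b \<bullet> b" by (rule primitive_norm_eq[OF a b nz])
  then show ?thesis using half[OF a b nz False] half[OF b a] nz False
    by (simp add: inner_commute comm add.commute)
qed simp

lemma f_eq_ln_det:
  assumes simple: "\<not> is_jordan_product mul"
  obtains k where "\<forall>x. pos x \<longrightarrow> f x = k * ln (jordan_det mul e x)"
proof -
  interpret simple_eja mul e by unfold_locales (rule simple)
  have "\<exists>k. \<forall>c. primitive_idempotent mul c \<longrightarrow> \<kappa> c = k"
  proof (cases "\<exists>a. primitive_idempotent mul a")
    case True
    then obtain a where a: "primitive_idempotent mul a" by blast
    have "\<kappa> c = \<kappa> a" if "primitive_idempotent mul c" for c
      by (rule primitive_connected[OF simple a _ _ that, where Q = "\<lambda>c. \<kappa> c = \<kappa> a"]) (auto dest: \<kappa>_primitive)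
    then show ?thesis by blast
  qed blast
  then obtain k where k: "\<And>c. primitive_idempotent mul c \<Longrightarrow> \<kappa> c = k" by blast
  have "f x = k * ln (jordan_det mul e x)" if x: "pos x" for x
  proof -
    obtain C l where C: "complete_system mul e C" and xl: "x = (\<Sum>c\<in>C. l c *\<^sub>R c)" and l: "\<forall>c\<in>C. 0 < l c"
      using spectral_pos[OF x] .
    have fin: "finite C" using C by (simp add: complete_system_def)
    have "f x = (\<Sum>c\<in>C. \<kappa> c * ln (l c))"
      unfolding xl using C l by (intro f_spectral) (simp_all add: complete_system_iff)
    also have "\<dots> = (\<Sum>c\<in>C. k * ln (l c))"
      using C k by (intro sum.cong) (auto simp: complete_system_iff)
    also have "\<dots> = k * (\<Sum>c\<in>C. ln (l c))" by (simp add: sum_distrib_left)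
    also have "(\<Sum>c\<in>C. ln (l c)) = ln (\<Prod>c\<in>C. l c)"
      using l fin by (intro ln_prod[symmetric]) auto
    also have "(\<Prod>c\<in>C. l c) = jordan_det mul e x" unfolding xl using jordan_det_eq[OF C l] by simp
    finally show ?thesis .
  qed
  then show ?thesis using that by blast
qed

end

section \<open>Solution of the functional equation\<close>

context simple_eja begin

text \<open>The scaling hypothesis holds once the linear part has been subtracted. The lemma serves
  for \<open>a\<close> directly and for \<open>b\<close> after exchanging the two variables.\<close>

lemma log_det_part:
  fixes a b c d :: "'a \<Rightarrow> real"
  assumes eqn: "\<And>x y. pos x \<Longrightarrow> pos y \<Longrightarrow> a x + b y = c (x + y) + d (P (inv_sqrt mul e (x + y)) x)"
    and cont: "continuous_on {x. pos x} a" "continuous_on {x. pos x} b"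
    and scale: "\<And>s x. 0 < s \<Longrightarrow> pos x \<Longrightarrow> a (s *\<^sub>R x) = a x + \<alpha> s"
  shows "\<exists>k. \<forall>x. pos x \<longrightarrow> a x = k * ln (jordan_det mul e x) + a e \<and> c x = a x + b x + (c e - a e - b e)"
proof -
  have M1: "c w = a w + b w + (c e - a e - b e)" if "pos w" for w
    using multiplicative_part(1)[of a b c d \<alpha> w] eqn cont(2) scale that by blast
  have M2: "a (P y x) - a e = (a x - a e) + (a (y \<odot> y) - a e)" if "pos y" "pos x" for x y
    using multiplicative_part(2)[of a b c d \<alpha> y x] eqn cont(2) scale that by blast
  interpret multiplicative_function mul e "\<lambda>x. a x - a e"
    by unfold_locales (use M2 in \<open>auto intro!: continuous_intros cont\<close>)
  obtain k where "\<forall>x. pos x \<longrightarrow> a x - a e = k * ln (jordan_det mul e x)"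
    using f_eq_ln_det[OF simple] .
  then show ?thesis using M1 by (intro exI[of _ k]) (auto simp: diff_eq_eq)
qed

lemma olkin_baker:
  fixes a b c d :: "'a \<Rightarrow> real"
  assumes eqn: "\<And>x y. pos x \<Longrightarrow> pos y \<Longrightarrow> a x + b y = c (x + y) + d (P (inv_sqrt mul e (x + y)) x)"
    and cont: "continuous_on {x. pos x} a" "continuous_on {x. pos x} b"
  shows "\<exists>k1 k2 \<Lambda> C1 C2 C3 C4. \<forall>x. pos x \<longrightarrow> (\<forall>u. pos u \<and> pos (e - u) \<longrightarrow>
      a x = \<Lambda> \<bullet> x + k1 * ln (jordan_det mul e x) + C1 \<and>
      b x = \<Lambda> \<bullet> x + k2 * ln (jordan_det mul e x) + C2 \<and>
      c x = \<Lambda> \<bullet> x + (k1 + k2) * ln (jordan_det mul e x) + C3 \<and>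
      d u = k1 * ln (jordan_det mul e u) + k2 * ln (jordan_det mul e (e - u)) + C4)"
proof -
  obtain \<Lambda> \<alpha> \<beta> where
    a: "\<And>s x. 0 < s \<Longrightarrow> pos x \<Longrightarrow> a (s *\<^sub>R x) = a x + (s - 1) * (\<Lambda> \<bullet> x) + \<alpha> s" and
    b: "\<And>s x. 0 < s \<Longrightarrow> pos x \<Longrightarrow> b (s *\<^sub>R x) = b x + (s - 1) * (\<Lambda> \<bullet> x) + \<beta> s"
    using scaling_behaviour[of a b c d] eqn cont(1) by blast
  \<comment> \<open>The same \<Lambda> belongs to \<open>a\<close> and \<open>b\<close>, so
    subtracting its linear form from \<open>a\<close>, \<open>b\<close> and \<open>c\<close>
    preserves the equation with \<open>d\<close> unchanged.\<close>
  define a' b' c' where "a' x = a x - \<Lambda> \<bullet> x" and "b' x = b x - \<Lambda> \<bullet> x" and "c' x = c x - \<Lambda> \<bullet> x" for x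
  have eqn': "a' x + b' y = c' (x + y) + d (P (inv_sqrt mul e (x + y)) x)" if "pos x" "pos y" for x y
    using eqn[OF that] by (simp add: a'_def b'_def c'_def inner_add_right)
  have cont': "continuous_on {x. pos x} a'" "continuous_on {x. pos x} b'"
    unfolding a'_def b'_def by (intro continuous_intros cont)+
  have scale_a: "a' (s *\<^sub>R x) = a' x + \<alpha> s" and scale_b: "b' (s *\<^sub>R x) = b' x + \<beta> s" if "0 < s" "pos x" for s x
    using a[OF that] b[OF that] by (simp_all add: a'_def b'_def algebra_simps)
  \<comment> \<open>Exchanging \<open>x\<close> and \<open>y\<close> replaces the quotient
    \<open>u\<close> by \<open>e - u\<close>, because the two quotients sum to
    \<open>e\<close>.\<close>
  have eqn'': "b' x + a' y = c' (x + y) + d (e - P (inv_sqrt mul e (x + y)) x)" if "pos x" "pos y" for x y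
  proof -
    have "P (inv_sqrt mul e (x + y)) (x + y) = e" using that by (intro P_inv_sqrt_self pos_add)
    then have "P (inv_sqrt mul e (x + y)) y = e - P (inv_sqrt mul e (x + y)) x"
      by (simp add: linear_add[OF linear_P] eq_diff_eq add.commute)
    then show ?thesis using eqn'[OF that(2,1)] by (simp add: add.commute)
  qed
  obtain k1 where "\<forall>x. pos x \<longrightarrow> a' x = k1 * ln (jordan_det mul e x) + a' e \<and>
      c' x = a' x + b' x + (c' e - a' e - b' e)"
    using log_det_part[of a' b' c' d \<alpha>, OF eqn' cont' scale_a] by blast
  then have k1: "\<forall>x. pos x \<longrightarrow> a' x = k1 * ln (jordan_det mul e x) + a' e"
    and c': "\<forall>x. pos x \<longrightarrow> c' x = a' x + b' x + (c' e - a' e - b' e)" by simp_all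
  obtain k2 where "\<forall>x. pos x \<longrightarrow> b' x = k2 * ln (jordan_det mul e x) + b' e \<and>
      c' x = b' x + a' x + (c' e - b' e - a' e)"
    using log_det_part[of b' a' c' "\<lambda>u. d (e - u)" \<beta>, OF eqn'' cont'(2,1) scale_b] by blast
  then have k2: "\<forall>x. pos x \<longrightarrow> b' x = k2 * ln (jordan_det mul e x) + b' e" by simp
  have d: "d u = k1 * ln (jordan_det mul e u) + k2 * ln (jordan_det mul e (e - u)) + (a' e + b' e - c' e)"
    if "pos u" "pos (e - u)" for u
  proof -
    \<comment> \<open>The pair \<open>u\<close>, \<open>e - u\<close> has sum \<open>e\<close>, so
      its quotient is \<open>u\<close> itself.\<close>
    have "a' u + b' (e - u) = c' e + d u" using eqn'[OF that] by (simp add: inv_sqrt_e)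
    then show ?thesis using k1[rule_format, OF that(1)] k2[rule_format, OF that(2)] by simp
  qed
  show ?thesis
  proof (intro exI allI impI conjI)
    fix x u assume x: "pos x" and "pos u \<and> pos (e - u)"
    then have u: "pos u" "pos (e - u)" by simp_all
    show "a x = \<Lambda> \<bullet> x + k1 * ln (jordan_det mul e x) + a' e"
      using k1[rule_format, OF x] by (simp add: a'_def)
    show "b x = \<Lambda> \<bullet> x + k2 * ln (jordan_det mul e x) + b' e"
      using k2[rule_format, OF x] by (simp add: b'_def)
    show "c x = \<Lambda> \<bullet> x + (k1 + k2) * ln (jordan_det mul e x) + c' e"
      using c'[rule_format, OF x] k1[rule_format, OF x] k2[rule_format, OF x]
      by (simp add: c'_def[of x] algebra_simps)
    show "d u = k1 * ln (jordan_det mul e u) + k2 * ln (jordan_det mul e (e - u)) + (a' e + b' e - c' e)"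
      by (rule d[OF u])
  qed
qed

end

theorem theorem3p1:
  fixes mul :: "'a::euclidean_space \<Rightarrow> 'a \<Rightarrow> 'a" and e :: 'a
    and V D :: "'a set" and a b c d :: "'a \<Rightarrow> real"
  assumes simple: "simple_euclidean_jordan_algebra mul e"
    and non_octonion: "\<not> octonion_type mul"
    and rank: "jordan_rank mul e \<noteq> 2"
    and V_eq: "V = symmetric_cone mul"
    and D_eq: "D = {z \<in> V. e - z \<in> V}"
    and cont: "continuous_on V a" "continuous_on V b" "continuous_on V c" "continuous_on D d"
    and eqn: "\<And>x y. x \<in> V \<Longrightarrow> y \<in> V \<Longrightarrow>
      a x + b y = c (x + y) + d (quad_rep mul (inv_sqrt mul e (x + y)) x)"
  shows "\<exists>(k1::real) (k2::real) (\<Lambda>::'a) (C1::real) (C2::real) (C3::real) (C4::real).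
    \<forall>x\<in>V. \<forall>u\<in>D.
      a x = \<Lambda> \<bullet> x + k1 * ln (jordan_det mul e x) + C1 \<and>
      b x = \<Lambda> \<bullet> x + k2 * ln (jordan_det mul e x) + C2 \<and>
      c x = \<Lambda> \<bullet> x + (k1 + k2) * ln (jordan_det mul e x) + C3 \<and>
      d u = k1 * ln (jordan_det mul e u) + k2 * ln (jordan_det mul e (e - u)) + C4"
proof -
  interpret simple_eja mul e
    using simple by unfold_locales (simp_all add: simple_euclidean_jordan_algebra_def)
  have V: "V = {x. pos x}" by (simp add: V_eq symmetric_cone_eq)
  have "a x + b y = c (x + y) + d (P (inv_sqrt mul e (x + y)) x)" if "pos x" "pos y" for x y
    using eqn[of x y] that by (simp add: V)
  then show ?thesis using olkin_baker[of a b c d] cont(1,2) unfolding D_eq V by simp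
qed

end
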